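(* Let $\gamma:J\to S$ be a unit speed smooth curve on a surface $S\subset\mathbb{R}^3$ with nowhere vanishing normal curvature $\kappa_n$. The goodness $\mathcal{M}(\gamma,\varepsilon)$ of the single Cartan ribbon approximation along the center curve $\gamma$ can be expressed in terms of the curvature functions $H(t)$, $K(t)$, $\kappa_n(t)$ and $\tau_g(t)$ along $\gamma$ as follows: $$\mathcal{M}(\gamma,\varepsilon)=\frac13\varepsilon^3\cdot\int_J F\bigl(H(t),K(t),\kappa_n(t),\tau_g(t)\bigr)\,dt+O(\varepsilon^4),$$ where $$F(H,K,\kappa_n,\tau_g)=\frac{\kappa_n^2}{(\kappa_n^2+\tau_g^2)^{3/2}}\cdot\left|\tau_g^2-\kappa_n^2+2H\kappa_n-2\tau_g\sqrt{2H\kappa_n-K-\kappa_n^2}\right|,$$ and $H(t)$, $K(t)$ denote the mean curvature and the Gaussian curvature of $S$ at $\gamma(t)$.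
   Context: $J=[0,\alpha]$. The Darboux frame field of $\gamma$ is $\{e,h,N\}$, where $N(t)$ is a (smoothly chosen) unit normal vector to $S$ at $\gamma(t)$, $e=\gamma'/\|\gamma'\|$ and $h=N\times e$. The geodesic curvature $\kappa_g$, normal curvature $\kappa_n$ and geodesic torsion $\tau_g$ are defined by $e'=\|\gamma'\|(\kappa_g h+\kappa_n N)$, $h'=\|\gamma'\|(-\kappa_g e+\tau_g N)$, $N'=\|\gamma'\|(-\kappa_n e-\tau_g h)$. The mean curvature is $H=\frac12(\kappa_1+\kappa_2)$, with the principal curvatures $\kappa_1,\kappa_2$ taken with respect to the normal $N$. The Cartan surface ribbon along $\gamma$ is the developable surface $\gamma(t)+u\,\beta(t)$ with $\beta(t)=\dfrac{\kappa_n(t)h(t)-\tau_g(t)e(t)}{\sqrt{\kappa_n^2(t)+\tau_g^2(t)}}$, $t\in J$, $u\in[-w_-(t),w_+(t)]$, with width functions $w_\pm>0$ such that the surface is regular; it has the same tangent planes as $S$ along $\gamma$, and $N(t)$ is its normal along the ruling at $t$. For $\varepsilon>0$ everywhere smaller than $w_-$ and $w_+$, the surface $S$ close to $\gamma$ is parametrized as a graph over the ribbon: $\sigma(t,u)=\gamma(t)+u\,\beta(t)+f(t,u)N(t)$, $t\in J$, $u\in[-\varepsilon,\varepsilon]$, with height function $f$ satisfying $f(t,0)=f'_u(t,0)=0$. The domain between $S$ and the ribbon is parametrized by $R(t,u,w)=\gamma(t)+u\,\beta(t)+w f(t,u)N(t)$, $t\in J$, $u\in[-\varepsilon,\varepsilon]$,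 $w\in[0,1]$, and the goodness is its volume $$\mathcal{M}(\gamma,\varepsilon)=\int_J\int_{-\varepsilon}^{\varepsilon}\int_0^1\left|(R'_t\times R'_u)\cdot R'_w\right|\,dw\,du\,dt .$$
   Formalization: The printed formula fails where τ_g<0 (e.g. a helix of one handedness on a cylinder has goodness 0 but F>0); it is proved as printed when τ_g≥0 on J, and for τ_g of any sign with τ_g in F replaced by |τ_g|. *)

theory Defs
  imports "HOL-Analysis.Analysis" "HOL-Library.Landau_Symbols"
begin

section \<open>Smooth maps\<close>

text \<open>
  On an open set, \<open>C_k n U f\<close> says that f has continuous (total) derivatives up to order n.
  On an arbitrary set A (here a compact interval or rectangle), smooth means, as usual, that there
  is a smooth extension to an open neighbourhood of A.
\<close>

primrec C_k :: "nat \<Rightarrow> 'a::euclidean_space set \<Rightarrow> ('a \<Rightarrow> 'b::real_normed_vector) \<Rightarrow> bool" where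
  "C_k 0 U f \<longleftrightarrow> continuous_on U f"
| "C_k (Suc n) U f \<longleftrightarrow> (\<forall>x\<in>U. f differentiable (at x)) \<and>
     (\<forall>v. C_k n U (\<lambda>x. frechet_derivative f (at x) v))"

definition smooth_on :: "'a::euclidean_space set \<Rightarrow> ('a \<Rightarrow> 'b::real_normed_vector) \<Rightarrow> bool" where
  "smooth_on A f \<longleftrightarrow>
     (\<exists>U g. open U \<and> A \<subseteq> U \<and> (\<forall>n. C_k n U g) \<and> (\<forall>x\<in>A. g x = f x))"


section \<open>Regular surfaces in \<open>\<real>\<^sup>3\<close> and their curvatures\<close>

definition local_parametrization ::
    "(real^3) set \<Rightarrow> (real \<times> real) set \<Rightarrow> (real \<times> real \<Rightarrow> real^3) \<Rightarrow> bool" where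
  "local_parametrization S U x \<longleftrightarrow>
     open U \<and> smooth_on U x \<and> openin (top_of_set S) (x ` U) \<and>
     (\<exists>y. homeomorphism U (x ` U) x y) \<and>
     (\<forall>q\<in>U. inj (frechet_derivative x (at q)))"

definition regular_surface :: "(real^3) set \<Rightarrow> bool" where
  "regular_surface S \<longleftrightarrow> (\<forall>p\<in>S. \<exists>U x. local_parametrization S U x \<and> p \<in> x ` U)"

definition tangent_plane :: "(real^3) set \<Rightarrow> real^3 \<Rightarrow> (real^3) set" where
  "tangent_plane S p =
     {frechet_derivative x (at q) \<xi> | U x q \<xi>. local_parametrization S U x \<and> q \<in> U \<and> x q = p}"

definition unit_normal :: "(real^3) set \<Rightarrow> real^3 \<Rightarrow> real^3 \<Rightarrow> bool" where
  "unit_normal S p n \<longleftrightarrow> norm n = 1 \<and> (\<forall>v\<in>tangent_plane S p. n \<bullet> v = 0)"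

text \<open>
  \<open>weingarten S p n v w\<close>: the Weingarten map (shape operator) \<open>- d\<nu>\<close> of S at p, for the local unit
  normal field \<open>\<nu>\<close> with value n at p, sends the tangent vector v to w. The normal field is given along
  a local parametrization x, so for \<open>v = dx(\<xi>)\<close> the image is \<open>w = - d(\<nu> \<circ> x)(\<xi>)\<close>.
\<close>

definition weingarten :: "(real^3) set \<Rightarrow> real^3 \<Rightarrow> real^3 \<Rightarrow> real^3 \<Rightarrow> real^3 \<Rightarrow> bool" where
  "weingarten S p n v w \<longleftrightarrow>
     (\<exists>U x \<nu> q \<xi>. local_parametrization S U x \<and> q \<in> U \<and> x q = p \<and>
        \<nu> differentiable_on U \<and> (\<forall>q'\<in>U. unit_normal S (x q') (\<nu> q')) \<and> \<nu> q = n \<and>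
        v = frechet_derivative x (at q) \<xi> \<and> w = - frechet_derivative \<nu> (at q) \<xi>)"

definition principal_curvatures :: "(real^3) set \<Rightarrow> real^3 \<Rightarrow> real^3 \<Rightarrow> real set" where
  "principal_curvatures S p n = {k. \<exists>v. v \<noteq> 0 \<and> weingarten S p n v (k *\<^sub>R v)}"

text \<open>
  The set of eigenvalues has one or two elements; taking its maximum and minimum as
  \<open>\<kappa>\<^sub>1\<close> and \<open>\<kappa>\<^sub>2\<close> also covers umbilic points, where \<open>\<kappa>\<^sub>1 = \<kappa>\<^sub>2\<close>.
\<close>

definition mean_curvature :: "(real^3) set \<Rightarrow> real^3 \<Rightarrow> real^3 \<Rightarrow> real" where
  "mean_curvature S p n =
     (Max (principal_curvatures S p n) + Min (principal_curvatures S p n)) / 2"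

definition gauss_curvature :: "(real^3) set \<Rightarrow> real^3 \<Rightarrow> real^3 \<Rightarrow> real" where
  "gauss_curvature S p n =
     Max (principal_curvatures S p n) * Min (principal_curvatures S p n)"


section \<open>Darboux frame\<close>

text \<open>Derivatives of curves on J are taken within J, i.e. one-sided at the end points.\<close>

definition unit_tangent :: "real set \<Rightarrow> (real \<Rightarrow> real^3) \<Rightarrow> real \<Rightarrow> real^3" where
  "unit_tangent J \<gamma> t =
     vector_derivative \<gamma> (at t within J) /\<^sub>R norm (vector_derivative \<gamma> (at t within J))"

definition conormal :: "real set \<Rightarrow> (real \<Rightarrow> real^3) \<Rightarrow> (real \<Rightarrow> real^3) \<Rightarrow> real \<Rightarrow> real^3" where
  "conormal J \<gamma> N t = cross3 (N t) (unit_tangent J \<gamma> t)"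

text \<open>
  The frame equations determine the geodesic curvature \<open>\<kappa>g\<close>, the normal curvature \<open>\<kappa>n\<close> and the
  geodesic torsion \<open>\<tau>g\<close> uniquely on J.
\<close>

definition darboux_equations ::
    "real set \<Rightarrow> (real \<Rightarrow> real^3) \<Rightarrow> (real \<Rightarrow> real^3) \<Rightarrow>
     (real \<Rightarrow> real) \<Rightarrow> (real \<Rightarrow> real) \<Rightarrow> (real \<Rightarrow> real) \<Rightarrow> bool" where
  "darboux_equations J \<gamma> N \<kappa>g \<kappa>n \<tau>g \<longleftrightarrow>
     (\<forall>t\<in>J.
        let e = unit_tangent J \<gamma>; h = conormal J \<gamma> N;
            v = norm (vector_derivative \<gamma> (at t within J))
        in (e has_vector_derivative v *\<^sub>R (\<kappa>g t *\<^sub>R h t + \<kappa>n t *\<^sub>R N t)) (at t within J) \<and>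
           (h has_vector_derivative v *\<^sub>R (- \<kappa>g t *\<^sub>R e t + \<tau>g t *\<^sub>R N t)) (at t within J) \<and>
           (N has_vector_derivative v *\<^sub>R (- \<kappa>n t *\<^sub>R e t - \<tau>g t *\<^sub>R h t)) (at t within J))"


section \<open>The Cartan ribbon and its goodness\<close>

definition ruling ::
    "real set \<Rightarrow> (real \<Rightarrow> real^3) \<Rightarrow> (real \<Rightarrow> real^3) \<Rightarrow> (real \<Rightarrow> real) \<Rightarrow> (real \<Rightarrow> real) \<Rightarrow>
     real \<Rightarrow> real^3" where
  "ruling J \<gamma> N \<kappa>n \<tau>g t =
     (\<kappa>n t *\<^sub>R conormal J \<gamma> N t - \<tau>g t *\<^sub>R unit_tangent J \<gamma> t) /\<^sub>R sqrt ((\<kappa>n t)\<^sup>2 + (\<tau>g t)\<^sup>2)"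

text \<open>
  The maps below take the ruling direction \<open>\<beta>\<close> as a parameter. A ribbon is regular if the two
  partial derivatives of its parametrization are linearly independent everywhere.
\<close>

definition ribbon :: "(real \<Rightarrow> real^3) \<Rightarrow> (real \<Rightarrow> real^3) \<Rightarrow> real \<Rightarrow> real \<Rightarrow> real^3" where
  "ribbon \<gamma> \<beta> t u = \<gamma> t + u *\<^sub>R \<beta> t"

definition regular_ribbon ::
    "real set \<Rightarrow> (real \<Rightarrow> real^3) \<Rightarrow> (real \<Rightarrow> real^3) \<Rightarrow> (real \<Rightarrow> real) \<Rightarrow> (real \<Rightarrow> real) \<Rightarrow> bool" where
  "regular_ribbon J \<gamma> \<beta> wm wp \<longleftrightarrow>
     (\<forall>t\<in>J. \<forall>u\<in>{- wm t..wp t}.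
        cross3 (vector_derivative (\<lambda>s. ribbon \<gamma> \<beta> s u) (at t within J))
               (vector_derivative (\<lambda>v. ribbon \<gamma> \<beta> t v) (at u within {- wm t..wp t})) \<noteq> 0)"

definition graph_over_ribbon ::
    "(real \<Rightarrow> real^3) \<Rightarrow> (real \<Rightarrow> real^3) \<Rightarrow> (real \<Rightarrow> real^3) \<Rightarrow> (real \<times> real \<Rightarrow> real) \<Rightarrow>
     real \<Rightarrow> real \<Rightarrow> real^3" where
  "graph_over_ribbon \<gamma> \<beta> N f t u = \<gamma> t + u *\<^sub>R \<beta> t + f (t, u) *\<^sub>R N t"

definition domain_between ::
    "(real \<Rightarrow> real^3) \<Rightarrow> (real \<Rightarrow> real^3) \<Rightarrow> (real \<Rightarrow> real^3) \<Rightarrow> (real \<times> real \<Rightarrow> real) \<Rightarrow>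
     real \<Rightarrow> real \<Rightarrow> real \<Rightarrow> real^3" where
  "domain_between \<gamma> \<beta> N f t u w = \<gamma> t + u *\<^sub>R \<beta> t + (w * f (t, u)) *\<^sub>R N t"

definition goodness ::
    "real \<Rightarrow> (real \<Rightarrow> real^3) \<Rightarrow> (real \<Rightarrow> real^3) \<Rightarrow> (real \<Rightarrow> real^3) \<Rightarrow> (real \<times> real \<Rightarrow> real) \<Rightarrow>
     real \<Rightarrow> real" where
  "goodness \<alpha> \<gamma> \<beta> N f \<epsilon> =
     (let R = domain_between \<gamma> \<beta> N f in
      integral {0..\<alpha>} (\<lambda>t. integral {-\<epsilon>..\<epsilon>} (\<lambda>u. integral {0..1} (\<lambda>w.
        \<bar>cross3 (vector_derivative (\<lambda>s. R s u w) (at t within {0..\<alpha>}))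
                (vector_derivative (\<lambda>v. R t v w) (at u within {-\<epsilon>..\<epsilon>}))
         \<bullet> vector_derivative (\<lambda>z. R t u z) (at w within {0..1})\<bar>))))"

text \<open>
  Along the curve \<open>2 H \<kappa>n - K - \<kappa>n\<^sup>2 = \<tau>g\<^sup>2\<close>, and the square root stands for the off-diagonal entry
  \<open>\<tau>g\<close> of the second fundamental form. The volume expansion therefore holds with this density where
  \<open>\<tau>g \<ge> 0\<close>; for negative \<open>\<tau>g\<close> the root has to be taken with the sign of \<open>\<tau>g\<close>, which amounts to
  evaluating the density at \<open>\<bar>\<tau>g\<bar>\<close>. With the nonnegative root it fails, e.g. for helices of one
  handedness on a circular cylinder, where the goodness is 0 but the density is positive.
\<close>

definition goodness_density :: "real \<Rightarrow> real \<Rightarrow> real \<Rightarrow> real \<Rightarrow> real" where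
  "goodness_density H K \<kappa>n \<tau>g =
     \<kappa>n\<^sup>2 / (\<kappa>n\<^sup>2 + \<tau>g\<^sup>2) powr (3/2) *
     \<bar>\<tau>g\<^sup>2 - \<kappa>n\<^sup>2 + 2 * H * \<kappa>n - 2 * \<tau>g * sqrt (2 * H * \<kappa>n - K - \<kappa>n\<^sup>2)\<bar>"

end

theory Submission
  imports Defs
begin

text \<open>
  In coordinates (t, u, w) the Jacobian of the domain between S and the ribbon is
  f * (a + u p + w f r), where \<open>a = (e \<times> \<beta>) \<bullet> N = \<kappa>n / sqrt (\<kappa>n\<^sup>2 + \<tau>g\<^sup>2)\<close> and p, r are bounded. Since f vanishes to
  second order in u, only \<open>f''\<^sub>u\<^sub>u(t, 0) u\<^sup>2 / 2 * a\<close> contributes at order \<open>\<epsilon>\<^sup>3\<close>. The coefficient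
  \<open>f''\<^sub>u\<^sub>u(t, 0)\<close> is \<open>II(\<beta>, \<beta>)\<close>, and in the Darboux frame the second fundamental form has the entries
  \<open>II(e, e) = \<kappa>n\<close>, \<open>II(e, h) = \<tau>g\<close> and \<open>II(h, h) = 2 H - \<kappa>n\<close>, with determinant K. In particular
  \<open>2 H \<kappa>n - K - \<kappa>n\<^sup>2 = \<tau>g\<^sup>2\<close>, so the root in the density is \<open>\<bar>\<tau>g\<bar>\<close>.

  The second fundamental form is taken in a chart x as the second derivative of \<open>n \<bullet> x\<close>. Its diagonal is
  the limit of \<open>2 n \<bullet> (c(s) - p) / s\<^sup>2\<close> along any curve c in S through p, which makes it independent of the
  chart and relates it to the height function f.
\<close>

section \<open>Second derivatives\<close>

text \<open>Two features of the definitions shape the proof. \<open>weingarten\<close> quantifies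
  existentially over charts and normal fields, so H and K are at first not attached to any one
  chart; the limit along curves replaces transition maps, and lines in the parameter domain supply
  curves in every tangent direction. And \<open>smooth_on\<close> on a compact set speaks of some
  extension, while \<kappa>n and \<tau>g are just functions on J that satisfy the frame equations;
  they are recovered as inner products of derivatives of the extended curve and normal, which makes
  the ruling continuously differentiable and, by compactness, the constants uniform in t. The entry
  II(h, h) cannot be read off the curve: the Darboux equations give only the row of II that belongs
  to e. It enters through H on one side and through f on the other, and eliminating it is what
  expresses the second u-derivative of f by the curvatures.\<close>

lemma smooth_on_open_differentiable:
  assumes "open U" "smooth_on U f" "x \<in> U"
  shows "f differentiable (at x)" "(\<lambda>y. frechet_derivative f (at y) v) differentiable (at x)"
proof -
  obtain V g where V: "open V" "U \<subseteq> V" "\<And>n. C_k n V g" "\<And>x. x \<in> U \<Longrightarrow> g x = f x"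
    using assms(2) unfolding smooth_on_def by blast
  have g: "g differentiable (at y)" if "y \<in> U" for y
    using V(3)[of 1] V(2) that by auto
  have eq: "(f has_derivative frechet_derivative g (at y)) (at y)" if "y \<in> U" for y
    using has_derivative_transform_within_open[OF _ assms(1) that V(4)] g[OF that]
    by (simp add: frechet_derivative_works)
  then show "f differentiable (at x)"
    using assms(3) differentiable_def by blast
  have "(\<lambda>y. frechet_derivative g (at y) v) differentiable (at x)"
    using V(3)[of 2] V(2) assms(3) by (auto simp: numeral_2_eq_2)
  moreover have "frechet_derivative g (at y) v = frechet_derivative f (at y) v" if "y \<in> U" for y
    using frechet_derivative_at[OF eq[OF that]] by simp
  ultimately show "(\<lambda>y. frechet_derivative f (at y) v) differentiable (at x)"
    unfolding differentiable_def
    by (metis (mono_tags, lifting) has_derivative_transform_within_open[OF _ assms(1,3)])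
qed

text \<open>The first derivative is assumed to be differentiable at the single point q only, and for
  each direction v separately. In \<open>B \<eta> v\<close> the second differentiation is along
  \<open>\<eta>\<close>, the first along v; bilinearity and symmetry of B are derived.\<close>

locale second_derivative =
  fixes g :: "'a::euclidean_space \<Rightarrow> real" and D :: "'a \<Rightarrow> 'a \<Rightarrow> real" and B :: "'a \<Rightarrow> 'a \<Rightarrow> real"
    and U :: "'a set" and q :: 'a
  assumes open_U: "open U" and q_in: "q \<in> U"
    and first: "\<And>y. y \<in> U \<Longrightarrow> (g has_derivative D y) (at y)"
    and second: "\<And>v. ((\<lambda>y. D y v) has_derivative (\<lambda>\<eta>. B \<eta> v)) (at q)"
begin

lemma linear_first: "y \<in> U \<Longrightarrow> linear (D y)"
  using first has_derivative_linear by blast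

lemma linear_left: "linear (\<lambda>\<eta>. B \<eta> v)"
  using second has_derivative_linear by blast

lemma linear_right: "linear (B \<eta>)"
proof -
  have "B \<xi> (v + w) = B \<xi> v + B \<xi> w" for \<xi> v w
  proof -
    have "((\<lambda>y. D y (v + w)) has_derivative (\<lambda>\<eta>. B \<eta> v + B \<eta> w)) (at q)"
      by (rule has_derivative_transform_within_open[OF _ open_U q_in, where f = "\<lambda>y. D y v + D y w"])
        (auto intro!: has_derivative_add second simp: linear_add linear_first)
    from fun_cong[OF has_derivative_unique[OF this second], of \<xi>] show ?thesis by simp
  qed
  moreover have "B \<xi> (c *\<^sub>R v) = c *\<^sub>R B \<xi> v" for \<xi> v c
  proof -
    have "((\<lambda>y. D y (c *\<^sub>R v)) has_derivative (\<lambda>\<eta>. c *\<^sub>R B \<eta> v)) (at q)"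
      by (rule has_derivative_transform_within_open[OF _ open_U q_in, where f = "\<lambda>y. c *\<^sub>R D y v"])
        (auto intro!: has_derivative_mult_right second simp: linear_cmul linear_first)
    from fun_cong[OF has_derivative_unique[OF this second], of \<xi>] show ?thesis by simp
  qed
  ultimately show ?thesis by (auto intro: linearI)
qed

text \<open>\<open>second\<close> yields one radius per direction. Taking the smallest over the
  finite basis and expanding v makes the radius independent of v; each basis term contributes at
  most \<open>e' * norm \<eta> * norm v\<close>, which is why \<open>e'\<close> is e divided by the
  dimension.\<close>

lemma uniform:
  assumes "e > 0"
  obtains d where "d > 0" "\<And>\<eta>. norm \<eta> < d \<Longrightarrow> q + \<eta> \<in> U"
    "\<And>\<eta> v. norm \<eta> < d \<Longrightarrow> \<bar>D (q + \<eta>) v - D q v - B \<eta> v\<bar> \<le> e * norm \<eta> * norm v"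
proof -
  define e' where "e' = e / DIM('a)"
  have "e' > 0" unfolding e'_def using assms by simp
  have ev: "\<forall>\<^sub>F y in nhds q. \<forall>b\<in>Basis. \<bar>D y b - D q b - B (y - q) b\<bar> \<le> e' * norm (y - q)"
  proof (rule eventually_ball_finite[OF finite_Basis], rule ballI)
    fix b :: 'a
    obtain d where "d > 0" "\<And>y. norm (y - q) < d \<Longrightarrow> norm (D y b - D q b - B (y - q) b) \<le> e' * norm (y - q)"
      using second[of b] \<open>e' > 0\<close> unfolding has_derivative_at_alt by meson
    then show "\<forall>\<^sub>F y in nhds q. \<bar>D y b - D q b - B (y - q) b\<bar> \<le> e' * norm (y - q)"
      unfolding eventually_nhds_metric by (auto simp: dist_norm)
  qed
  have "\<forall>\<^sub>F y in nhds q. y \<in> U"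
    using open_U q_in by (simp add: eventually_nhds_in_open)
  with ev have "\<forall>\<^sub>F y in nhds q. y \<in> U \<and> (\<forall>b\<in>Basis. \<bar>D y b - D q b - B (y - q) b\<bar> \<le> e' * norm (y - q))"
    by (simp add: eventually_conj_iff)
  then obtain d where d: "d > 0"
    "\<And>y. norm (y - q) < d \<Longrightarrow> y \<in> U \<and> (\<forall>b\<in>Basis. \<bar>D y b - D q b - B (y - q) b\<bar> \<le> e' * norm (y - q))"
    unfolding eventually_nhds_metric by (auto simp: dist_norm)
  show thesis
  proof (rule that[OF d(1)])
    fix \<eta> :: 'a assume \<eta>: "norm \<eta> < d"
    then show U: "q + \<eta> \<in> U" using d(2)[of "q + \<eta>"] by simp
    fix v :: 'a
    have expand: "L v = (\<Sum>b\<in>Basis. (v \<bullet> b) * L b)" if "linear L" for L :: "'a \<Rightarrow> real"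
      using linear_sum[OF that, of "\<lambda>b. (v \<bullet> b) *\<^sub>R b" Basis]
      by (simp add: euclidean_representation linear_cmul[OF that])
    have "D (q + \<eta>) v - D q v - B \<eta> v
        = (\<Sum>b\<in>Basis. (v \<bullet> b) * (D (q + \<eta>) b - D q b - B \<eta> b))"
      using expand[OF linear_first[OF U]] expand[OF linear_first[OF q_in]] expand[OF linear_right[of \<eta>]]
      by (simp add: algebra_simps sum_subtractf sum.distrib)
    also have "\<bar>\<dots>\<bar> \<le> (\<Sum>b\<in>(Basis::'a set). norm v * (e' * norm \<eta>))"
    proof (rule order.trans[OF sum_abs sum_mono])
      fix b :: 'a assume b: "b \<in> Basis"
      have "\<bar>D (q + \<eta>) b - D q b - B \<eta> b\<bar> \<le> e' * norm \<eta>"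
        using d(2)[of "q + \<eta>"] \<eta> b by simp
      then show "\<bar>(v \<bullet> b) * (D (q + \<eta>) b - D q b - B \<eta> b)\<bar> \<le> norm v * (e' * norm \<eta>)"
        unfolding abs_mult using Basis_le_norm[OF b, of v] by (intro mult_mono) auto
    qed
    also have "\<dots> = e * norm \<eta> * norm v"
      unfolding e'_def by simp
    finally show "\<bar>D (q + \<eta>) v - D q v - B \<eta> v\<bar> \<le> e * norm \<eta> * norm v" .
  qed
qed

text \<open>The offset lets the line start away from q: \<open>second_difference\<close> compares
  parallel lines through q and through \<open>q + s *\<^sub>R \<eta>\<close>.\<close>

lemma along_line:
  assumes "q + a + s *\<^sub>R v \<in> U"
  shows "((\<lambda>s. g (q + a + s *\<^sub>R v)) has_real_derivative D (q + a + s *\<^sub>R v) v) (at s)"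
proof -
  have "((\<lambda>s. q + a + s *\<^sub>R v) has_derivative (\<lambda>h. h *\<^sub>R v)) (at s)"
    by (auto intro!: derivative_eq_intros)
  from has_derivative_compose[OF this first[OF assms]]
  show ?thesis
    by (rule has_derivative_imp_has_field_derivative)
      (simp add: linear_cmul[OF linear_first[OF assms]])
qed

text \<open>Apply the mean value theorem to g along the segment minus its quadratic Taylor
  polynomial: the derivative at z is precisely the error that \<open>uniform\<close> controls at
  \<open>z *\<^sub>R \<eta>\<close>. This gives a Peano remainder from second differentiability at q
  alone.\<close>

lemma taylor:
  assumes "e > 0"
  obtains d where "d > 0"
    "\<And>\<eta>. norm \<eta> < d \<Longrightarrow> \<bar>g (q + \<eta>) - g q - D q \<eta> - B \<eta> \<eta> / 2\<bar> \<le> e * (norm \<eta>)\<^sup>2"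
proof -
  obtain d where d: "d > 0" "\<And>\<eta>. norm \<eta> < d \<Longrightarrow> q + \<eta> \<in> U"
    "\<And>\<eta> v. norm \<eta> < d \<Longrightarrow> \<bar>D (q + \<eta>) v - D q v - B \<eta> v\<bar> \<le> e * norm \<eta> * norm v"
    using uniform[OF assms] by blast
  show thesis
  proof (rule that[OF d(1)])
    fix \<eta> :: 'a assume \<eta>: "norm \<eta> < d"
    have small: "norm (s *\<^sub>R \<eta>) < d" if "0 \<le> s" "s \<le> 1" for s
      using \<eta> mult_right_mono[OF that(2), of "norm \<eta>"] that by simp
    define \<phi> where "\<phi> s = g (q + 0 + s *\<^sub>R \<eta>) - s * D q \<eta> - s\<^sup>2 / 2 * B \<eta> \<eta>" for s
    have "\<exists>z>0. z < 1 \<and> \<phi> 1 - \<phi> 0 = (1 - 0) * (D (q + 0 + z *\<^sub>R \<eta>) \<eta> - D q \<eta> - z * B \<eta> \<eta>)"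
      unfolding \<phi>_def
      by (rule MVT2) (auto intro!: derivative_eq_intros along_line[where a = 0, simplified] d(2) small simp: algebra_simps)
    then obtain z where z: "0 < z" "z < 1" "\<phi> 1 - \<phi> 0 = D (q + z *\<^sub>R \<eta>) \<eta> - D q \<eta> - z * B \<eta> \<eta>"
      by auto
    have "\<bar>D (q + z *\<^sub>R \<eta>) \<eta> - D q \<eta> - B (z *\<^sub>R \<eta>) \<eta>\<bar> \<le> e * norm (z *\<^sub>R \<eta>) * norm \<eta>"
      using d(3)[OF small] z by simp
    also have "\<dots> \<le> e * norm \<eta> * norm \<eta>"
      using z assms by (intro mult_right_mono mult_left_mono) (auto simp: mult_left_le_one_le)
    finally show "\<bar>g (q + \<eta>) - g q - D q \<eta> - B \<eta> \<eta> / 2\<bar> \<le> e * (norm \<eta>)\<^sup>2"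
      using z(3) linear_cmul[OF linear_left[of \<eta>], of z \<eta>] by (simp add: \<phi>_def power2_eq_square)
  qed
qed

text \<open>The second difference compares the increments in direction \<xi> at two base points, and
  the mean value theorem turns it into a difference of values of D along \<xi>.
  \<open>uniform\<close> costs one error at each point (the factor 2), and the terms
  \<open>D q \<xi>\<close> and \<open>z * B \<xi> \<xi>\<close> cancel.\<close>

lemma second_difference:
  assumes "e > 0" and d: "\<And>\<eta>. norm \<eta> < d \<Longrightarrow> q + \<eta> \<in> U"
    "\<And>\<eta> v. norm \<eta> < d \<Longrightarrow> \<bar>D (q + \<eta>) v - D q v - B \<eta> v\<bar> \<le> e * norm \<eta> * norm v"
    and s: "s > 0" "s * (norm \<xi> + norm \<eta>) < d"
  shows "\<bar>g (q + s *\<^sub>R \<xi> + s *\<^sub>R \<eta>) - g (q + s *\<^sub>R \<xi>) - g (q + s *\<^sub>R \<eta>) + g q - s\<^sup>2 * B \<eta> \<xi>\<bar>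
    \<le> 2 * e * s\<^sup>2 * (norm \<xi> + norm \<eta>)\<^sup>2"
proof -
  let ?M = "norm \<xi> + norm \<eta>"
  have le1: "norm (r *\<^sub>R \<xi>) \<le> s * ?M" if "0 \<le> r" "r \<le> s" for r
    using mult_mono[of r s "norm \<xi>" ?M] that by simp
  have le2: "norm (s *\<^sub>R \<eta> + r *\<^sub>R \<xi>) \<le> s * ?M" if "0 \<le> r" "r \<le> s" for r
    using norm_triangle_ineq[of "s *\<^sub>R \<eta>" "r *\<^sub>R \<xi>"] mult_right_mono[OF that(2), of "norm \<xi>"] that s
    by (simp add: algebra_simps)
  have in_U: "q + r *\<^sub>R \<xi> \<in> U" "q + s *\<^sub>R \<eta> + r *\<^sub>R \<xi> \<in> U" if "0 \<le> r" "r \<le> s" for r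
    using d(1)[of "r *\<^sub>R \<xi>"] d(1)[of "s *\<^sub>R \<eta> + r *\<^sub>R \<xi>"] le1[OF that] le2[OF that] s
    by (auto simp: add.assoc)
  define \<phi> where "\<phi> r = g (q + s *\<^sub>R \<eta> + r *\<^sub>R \<xi>) - g (q + 0 + r *\<^sub>R \<xi>)" for r
  have "\<exists>z>0. z < s \<and> \<phi> s - \<phi> 0 = (s - 0) * (D (q + s *\<^sub>R \<eta> + z *\<^sub>R \<xi>) \<xi> - D (q + 0 + z *\<^sub>R \<xi>) \<xi>)"
    unfolding \<phi>_def
    using s in_U by (intro MVT2 DERIV_diff along_line) auto
  then obtain z where z: "0 < z" "z < s"
    "\<phi> s - \<phi> 0 = s * (D (q + s *\<^sub>R \<eta> + z *\<^sub>R \<xi>) \<xi> - D (q + z *\<^sub>R \<xi>) \<xi>)"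
    by auto
  have 1: "\<bar>D (q + (s *\<^sub>R \<eta> + z *\<^sub>R \<xi>)) \<xi> - D q \<xi> - B (s *\<^sub>R \<eta> + z *\<^sub>R \<xi>) \<xi>\<bar> \<le> e * (s * ?M) * ?M"
    using le2[of z] z s assms(1)
    by (intro order.trans[OF d(2)] mult_mono mult_left_mono) auto
  have 2: "\<bar>D (q + z *\<^sub>R \<xi>) \<xi> - D q \<xi> - B (z *\<^sub>R \<xi>) \<xi>\<bar> \<le> e * (s * ?M) * ?M"
    using le1[of z] z s assms(1)
    by (intro order.trans[OF d(2)] mult_mono mult_left_mono) auto
  have "\<bar>D (q + s *\<^sub>R \<eta> + z *\<^sub>R \<xi>) \<xi> - D (q + z *\<^sub>R \<xi>) \<xi> - s * B \<eta> \<xi>\<bar> \<le> 2 * (e * (s * ?M) * ?M)"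
    using 1 2 linear_add[OF linear_left[of \<xi>], of "s *\<^sub>R \<eta>" "z *\<^sub>R \<xi>"]
      linear_cmul[OF linear_left[of \<xi>], of s \<eta>]
    by (simp add: add.assoc)
  then have "s * \<bar>D (q + s *\<^sub>R \<eta> + z *\<^sub>R \<xi>) \<xi> - D (q + z *\<^sub>R \<xi>) \<xi> - s * B \<eta> \<xi>\<bar>
      \<le> s * (2 * (e * (s * ?M) * ?M))"
    using s by (intro mult_left_mono) auto
  moreover have "s * \<bar>D (q + s *\<^sub>R \<eta> + z *\<^sub>R \<xi>) \<xi> - D (q + z *\<^sub>R \<xi>) \<xi> - s * B \<eta> \<xi>\<bar> = \<bar>\<phi> s - \<phi> 0 - s\<^sup>2 * B \<eta> \<xi>\<bar>"
    using s z(3) abs_mult[of s "D (q + s *\<^sub>R \<eta> + z *\<^sub>R \<xi>) \<xi> - D (q + z *\<^sub>R \<xi>) \<xi> - s * B \<eta> \<xi>"]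
    by (simp add: algebra_simps power2_eq_square)
  ultimately show ?thesis
    by (simp add: \<phi>_def algebra_simps power2_eq_square)
qed

text \<open>Young's form of Schwarz's theorem: the second difference is symmetric in \<xi> and
  \<eta>, and divided by \<open>s\<^sup>2\<close> it approximates both \<open>B \<eta> \<xi>\<close>
  and \<open>B \<xi> \<eta>\<close>. Their distance is therefore at most a fixed multiple of the
  arbitrary e.\<close>

lemma commute: "B \<xi> \<eta> = B \<eta> \<xi>"
proof -
  let ?M = "norm \<xi> + norm \<eta>"
  have bound: "\<bar>B \<eta> \<xi> - B \<xi> \<eta>\<bar> \<le> e * (4 * ?M\<^sup>2)" if "e > 0" for e
  proof -
    obtain d where d: "d > 0" "\<And>\<eta>. norm \<eta> < d \<Longrightarrow> q + \<eta> \<in> U"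
      "\<And>\<eta> v. norm \<eta> < d \<Longrightarrow> \<bar>D (q + \<eta>) v - D q v - B \<eta> v\<bar> \<le> e * norm \<eta> * norm v"
      using uniform[OF \<open>e > 0\<close>] by blast
    \<comment> \<open>The \<open>+ 1\<close> avoids a division by zero and makes
      \<open>s * ?M < d\<close> strict.\<close>
    define s where "s = d / (?M + 1)"
    have M: "?M + 1 > 0" by (smt (verit) norm_ge_zero)
    have s: "s > 0" "s * ?M < d"
      using d(1) M unfolding s_def by (auto simp: field_simps)
    have "\<bar>g (q + s *\<^sub>R \<xi> + s *\<^sub>R \<eta>) - g (q + s *\<^sub>R \<xi>) - g (q + s *\<^sub>R \<eta>) + g q - s\<^sup>2 * B \<eta> \<xi>\<bar>
        \<le> 2 * e * s\<^sup>2 * ?M\<^sup>2"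
      by (rule second_difference[OF \<open>e > 0\<close> d(2,3) s])
    moreover have "\<bar>g (q + s *\<^sub>R \<eta> + s *\<^sub>R \<xi>) - g (q + s *\<^sub>R \<eta>) - g (q + s *\<^sub>R \<xi>) + g q - s\<^sup>2 * B \<xi> \<eta>\<bar>
        \<le> 2 * e * s\<^sup>2 * (norm \<eta> + norm \<xi>)\<^sup>2"
      by (rule second_difference[OF \<open>e > 0\<close> d(2,3) s(1)]) (use s(2) in \<open>simp_all add: add.commute\<close>)
    ultimately have "\<bar>s\<^sup>2 * B \<eta> \<xi> - s\<^sup>2 * B \<xi> \<eta>\<bar> \<le> 4 * e * s\<^sup>2 * ?M\<^sup>2"
      by (simp add: add_ac)
    then have "s\<^sup>2 * \<bar>B \<eta> \<xi> - B \<xi> \<eta>\<bar> \<le> s\<^sup>2 * (e * (4 * ?M\<^sup>2))"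
      by (metis (no_types, lifting) abs_mult abs_power2 mult.assoc mult.commute mult.left_commute right_diff_distrib')
    then show ?thesis using s by simp
  qed
  have "\<bar>B \<eta> \<xi> - B \<xi> \<eta>\<bar> \<le> 0"
  proof (rule field_le_epsilon)
    fix e :: real assume "e > 0"
    have "4 * ?M\<^sup>2 + 1 > 0" by (simp add: add_nonneg_pos)
    have "\<bar>B \<eta> \<xi> - B \<xi> \<eta>\<bar> \<le> e / (4 * ?M\<^sup>2 + 1) * (4 * ?M\<^sup>2)"
      using \<open>e > 0\<close> \<open>4 * ?M\<^sup>2 + 1 > 0\<close> by (intro bound divide_pos_pos)
    also have "\<dots> \<le> e"
      using \<open>e > 0\<close> \<open>4 * ?M\<^sup>2 + 1 > 0\<close> by (simp add: field_simps)
    finally show "\<bar>B \<eta> \<xi> - B \<xi> \<eta>\<bar> \<le> 0 + e" by simp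
  qed
  then show ?thesis by simp
qed

end

section \<open>Curves in a chart and the second fundamental form\<close>

locale chart =
  fixes S :: "(real^3) set" and U :: "(real \<times> real) set" and x :: "real \<times> real \<Rightarrow> real^3" and q
  assumes param: "local_parametrization S U x" and q_in: "q \<in> U"
begin

abbreviation dx :: "real \<times> real \<Rightarrow> real \<times> real \<Rightarrow> real^3" where
  "dx y \<equiv> frechet_derivative x (at y)"

text \<open>The arguments are parameter vectors, not tangent vectors: a tangent vector v enters
  through the \<xi> with \<open>dx q \<xi> = v\<close>, unique because \<open>dx q\<close> is
  injective. As n is a constant vector, no normal field has to be differentiated.\<close>

definition II :: "real^3 \<Rightarrow> real \<times> real \<Rightarrow> real \<times> real \<Rightarrow> real" where
  "II n \<xi> \<eta> = n \<bullet> frechet_derivative (\<lambda>y. dx y \<eta>) (at q) \<xi>"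

lemma open_U: "open U"
  using param unfolding local_parametrization_def by blast

lemma chart_at: "y \<in> U \<Longrightarrow> chart S U x y"
  using param by unfold_locales

lemma has_derivative: "y \<in> U \<Longrightarrow> (x has_derivative dx y) (at y)"
  using smooth_on_open_differentiable(1)[of U x] param frechet_derivative_works
  unfolding local_parametrization_def by blast

lemma has_derivative_dx:
  "((\<lambda>y. dx y v) has_derivative frechet_derivative (\<lambda>y. dx y v) (at q)) (at q)"
  using smooth_on_open_differentiable(2)[of U x q v] param q_in frechet_derivative_works
  unfolding local_parametrization_def by blast

lemma linear_dx: "y \<in> U \<Longrightarrow> linear (dx y)"
  using has_derivative has_derivative_linear by blast

lemma inj_dx: "y \<in> U \<Longrightarrow> inj (dx y)"
  using param unfolding local_parametrization_def by blast

lemma second_derivative: "second_derivative (\<lambda>y. n \<bullet> x y) (\<lambda>y v. n \<bullet> dx y v) (II n) U q"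
  unfolding II_def
  by unfold_locales (auto intro!: open_U q_in has_derivative_inner_right has_derivative has_derivative_dx)

lemma second_form_commute: "II n \<xi> \<eta> = II n \<eta> \<xi>"
  by (rule second_derivative.commute[OF second_derivative])

lemma second_form_linear: "linear (II n \<xi>)"
  by (rule second_derivative.linear_right[OF second_derivative])

lemma second_form_simps:
  "II n \<xi> (v + w) = II n \<xi> v + II n \<xi> w" "II n (v + w) \<xi> = II n v \<xi> + II n w \<xi>"
  "II n \<xi> (c *\<^sub>R v) = c * II n \<xi> v" "II n (c *\<^sub>R v) \<xi> = c * II n v \<xi>"
  using linear_add[OF second_form_linear, of n \<xi> v w] linear_cmul[OF second_form_linear, of n \<xi> c v]
  by (simp_all add: second_form_commute[of n _ \<xi>])

text \<open>Inclusion plus equal dimension: the injective linear image of the parameter plane and a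
  hyperplane of 3-space both have dimension 2.\<close>

lemma range_dx:
  assumes "n \<noteq> 0" "\<And>\<eta>. n \<bullet> dx q \<eta> = 0"
  shows "range (dx q) = {v. n \<bullet> v = 0}"
proof (rule subspace_dim_equal)
  show "subspace (range (dx q))" "subspace {v. n \<bullet> v = 0}"
    using linear_subspace_image[OF linear_dx[OF q_in] subspace_UNIV] subspace_hyperplane by auto
  show "range (dx q) \<subseteq> {v. n \<bullet> v = 0}" using assms(2) by auto
  show "dim {v. n \<bullet> v = 0} \<le> dim (range (dx q))"
    using dim_image_eq[OF linear_dx[OF q_in], of UNIV] inj_dx[OF q_in] dim_hyperplane[OF assms(1)]
    by (simp add: dim_UNIV)
qed

text \<open>
  A curve in S lifts differentiably to the parameter domain: the left inverse of the injective
  differential turns the first-order expansion of x at q into one for the lift, so no inverse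
  function theorem is needed.
\<close>

lemma curve_lift:
  fixes c :: "real \<Rightarrow> real^3"
  assumes T: "t0 \<in> T" "at t0 within T \<noteq> bot"
    and c: "c ` T \<subseteq> S" "c t0 = x q" "(c has_vector_derivative v) (at t0 within T)"
  obtains Q \<xi> where "dx q \<xi> = v" "Q t0 = q" "(Q has_vector_derivative \<xi>) (at t0 within T)"
    "\<forall>\<^sub>F s in at t0 within T. Q s \<in> U \<and> x (Q s) = c s"
proof -
  obtain y where y: "homeomorphism U (x ` U) x y" and "openin (top_of_set S) (x ` U)"
    using param unfolding local_parametrization_def by blast
  then obtain W where W: "open W" "x ` U = S \<inter> W"
    unfolding openin_open by blast
  have c_cont: "(c \<longlongrightarrow> x q) (at t0 within T)"
    using has_vector_derivative_continuous[OF c(3)] c(2) by (simp add: continuous_within)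
  have in_T: "\<forall>\<^sub>F s in at t0 within T. s \<in> T"
    by (simp add: eventually_at_topological) blast
  have "x q \<in> W" using W q_in by blast
  \<comment> \<open>The image of the chart is relatively open in S, so c stays inside it for s near
    t0.\<close>
  have in_W: "\<forall>\<^sub>F s in at t0 within T. c s \<in> x ` U"
    unfolding W(2)
    by (rule eventually_mono[OF eventually_conj[OF topological_tendstoD[OF c_cont W(1) \<open>x q \<in> W\<close>] in_T]])
      (use c(1) in blast)
  define Q where "Q s = y (c s)" for s
  have lift: "\<forall>\<^sub>F s in at t0 within T. Q s \<in> U \<and> x (Q s) = c s"
    using in_W by eventually_elim (use y in \<open>auto simp: Q_def homeomorphism_def\<close>)
  have Q0: "Q t0 = q" using y q_in c(2) by (simp add: Q_def homeomorphism_def)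
  have y_cont: "continuous_on (x ` U) y" using y by (simp add: homeomorphism_def)
  have Q_lim: "(Q \<longlongrightarrow> q) (at t0 within T)"
    unfolding Q_def
    using continuous_on_tendsto_compose[OF y_cont c_cont _ in_W] y q_in
    by (simp add: homeomorphism_def)
  obtain g where g: "linear g" "g \<circ> dx q = id"
    using linear_injective_left_inverse[OF linear_dx[OF q_in] inj_dx[OF q_in]] by blast
  obtain M where M: "M > 0" "\<And>z. norm (g z) \<le> M * norm z"
    using linear_bounded_pos[OF g(1)] by blast
  have g_dx: "g (dx q \<eta>) = \<eta>" for \<eta> using g(2) by (metis comp_apply id_apply)
  define \<xi> where "\<xi> = g v"
  have c_est: "\<forall>\<^sub>F s in at t0 within T. norm (c s - x q - (s - t0) *\<^sub>R v) \<le> e * \<bar>s - t0\<bar>" if "e > 0" for e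
    using c(3) that unfolding has_vector_derivative_def has_derivative_within_alt2 c(2)
    by auto
  have x_est: "\<forall>\<^sub>F s in at t0 within T. norm (x (Q s) - x q - dx q (Q s - q)) \<le> e * norm (Q s - q)" if "e > 0" for e
  proof -
    have "\<exists>d>0. \<forall>z. norm (z - q) < d \<longrightarrow> norm (x z - x q - dx q (z - q)) \<le> e * norm (z - q)"
      using has_derivative[OF q_in] that by (simp only: has_derivative_at_alt)
    then obtain d where d: "d > 0" "\<And>z. norm (z - q) < d \<Longrightarrow> norm (x z - x q - dx q (z - q)) \<le> e * norm (z - q)"
      by auto
    have "\<forall>\<^sub>F s in at t0 within T. norm (Q s - q) < d"
      using tendstoD[OF Q_lim \<open>d > 0\<close>] by (simp add: dist_norm)
    then show ?thesis by (rule eventually_mono) (rule d)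
  qed
  \<comment> \<open>With tolerance \<open>1 / (2 * M)\<close> in \<open>x_est\<close>, half of
    \<open>norm (Q s - q)\<close> is absorbed on the left, which doubles M; the factor
    \<open>norm v + 1\<close> comes from \<open>c_est\<close> with tolerance 1.\<close>
  define C where "C = 2 * M * (norm v + 1)"
  have Q_bound: "\<forall>\<^sub>F s in at t0 within T. norm (Q s - q) \<le> C * \<bar>s - t0\<bar>"
  proof -
    have "\<forall>\<^sub>F s in at t0 within T. norm (c s - x q - (s - t0) *\<^sub>R v) \<le> 1 * \<bar>s - t0\<bar>"
      by (rule c_est) simp
    moreover have "1 / (2 * M) > 0" using M by simp
    note x_est[OF this]
    ultimately show ?thesis using lift
    proof eventually_elim
      case (elim s)
      have "Q s - q = g (x (Q s) - x q) - g (x (Q s) - x q - dx q (Q s - q))"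
        by (simp add: linear_diff[OF g(1)] g_dx)
      then have "norm (Q s - q) \<le> norm (g (c s - x q)) + norm (g (x (Q s) - x q - dx q (Q s - q)))"
        using elim norm_triangle_ineq4 by metis
      also have "\<dots> \<le> M * norm (c s - x q) + M * (1 / (2 * M) * norm (Q s - q))"
        using M(1) elim by (intro add_mono order.trans[OF M(2)] mult_left_mono) auto
      also have "\<dots> = M * norm (c s - x q) + norm (Q s - q) / 2"
        using M(1) by simp
      finally have "norm (Q s - q) \<le> 2 * M * norm (c s - x q)" by simp
      moreover have "norm (c s - x q) \<le> norm ((s - t0) *\<^sub>R v) + \<bar>s - t0\<bar>"
        using norm_triangle_ineq[of "c s - x q - (s - t0) *\<^sub>R v" "(s - t0) *\<^sub>R v"] elim by simp
      then have "norm (c s - x q) \<le> (norm v + 1) * \<bar>s - t0\<bar>"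
        by (simp only: norm_scaleR) argo
      from mult_left_mono[OF this, of "2 * M"] have "2 * M * norm (c s - x q) \<le> C * \<bar>s - t0\<bar>"
        using M(1) by (simp add: C_def mult.assoc)
      ultimately show ?case by simp
    qed
  qed
  have "C > 0" unfolding C_def using M by (simp add: add_nonneg_pos)
  have Q_deriv: "(Q has_vector_derivative \<xi>) (at t0 within T)"
    unfolding has_vector_derivative_def has_derivative_within_alt2
  proof (intro conjI allI impI)
    show "bounded_linear (\<lambda>h. h *\<^sub>R \<xi>)" by (rule bounded_linear_scaleR_left)
    fix e :: real assume "e > 0"
    \<comment> \<open>Both remainders pass through g, which costs M, and the one of x is also
      rescaled by \<open>Q_bound\<close>, which costs C; each then contributes e/2 times
      \<open>\<bar>s - t0\<bar>\<close>.\<close>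
    have "e / (2 * M * C) > 0" "e / (2 * M) > 0" using \<open>e > 0\<close> M \<open>C > 0\<close> by auto
    from x_est[OF this(1)] c_est[OF this(2)] Q_bound lift
    show "\<forall>\<^sub>F s in at t0 within T. norm (Q s - Q t0 - (s - t0) *\<^sub>R \<xi>) \<le> e * norm (s - t0)"
    proof eventually_elim
      case (elim s)
      have "Q s - Q t0 - (s - t0) *\<^sub>R \<xi>
          = g (c s - x q - (s - t0) *\<^sub>R v) - g (x (Q s) - x q - dx q (Q s - q))"
        using elim by (simp add: linear_diff[OF g(1)] linear_cmul[OF g(1)] g_dx \<xi>_def Q0)
      then have "norm (Q s - Q t0 - (s - t0) *\<^sub>R \<xi>)
          \<le> norm (g (c s - x q - (s - t0) *\<^sub>R v)) + norm (g (x (Q s) - x q - dx q (Q s - q)))"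
        using norm_triangle_ineq4 by metis
      also have "\<dots> \<le> M * (e / (2 * M) * \<bar>s - t0\<bar>) + M * (e / (2 * M * C) * (C * \<bar>s - t0\<bar>))"
        using M(1) elim \<open>e > 0\<close> \<open>C > 0\<close>
        by (intro add_mono order.trans[OF M(2)] mult_left_mono order.trans[OF elim(1)]) auto
      also have "\<dots> = e * norm (s - t0)"
        using M(1) \<open>C > 0\<close> by simp
      finally show ?case .
    qed
  qed
  have "dx q \<xi> = v"
  proof (rule vector_derivative_unique_within[OF T(2) _ c(3)])
    have "((\<lambda>s. x (Q s)) has_vector_derivative dx q \<xi>) (at t0 within T)"
      using vector_derivative_diff_chain_within[OF Q_deriv, of x "dx q"] 
        has_derivative_at_withinI[OF has_derivative[OF q_in]] by (simp add: Q0 o_def)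
    then show "(c has_vector_derivative dx q \<xi>) (at t0 within T)"
      unfolding has_vector_derivative_def
      by (rule has_derivative_transform_eventually) (use lift T(1) Q0 c(2) in \<open>auto elim: eventually_mono\<close>)
  qed
  then show thesis using that Q0 Q_deriv lift by blast
qed

text \<open>As n annihilates the image of \<open>dx q\<close>, the linear term in the Taylor
  expansion of \<open>n \<bullet> x\<close> drops out. The quadratic term divided by
  \<open>(s - t0)\<^sup>2\<close> is half of II at the difference quotient \<open>P s\<close> of the
  lift, and \<open>P s\<close> tends to \<xi>. So this second-order limit exists although c is only
  assumed to be differentiable once, at t0.\<close>

lemma curve_second_order:
  fixes c :: "real \<Rightarrow> real^3"
  assumes T: "t0 \<in> T" "at t0 within T \<noteq> bot"
    and c: "c ` T \<subseteq> S" "c t0 = x q" "(c has_vector_derivative v) (at t0 within T)"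
    and n: "\<And>\<eta>. n \<bullet> dx q \<eta> = 0"
  obtains \<xi> where "dx q \<xi> = v"
    "((\<lambda>s. n \<bullet> (c s - c t0) / (s - t0)\<^sup>2) \<longlongrightarrow> II n \<xi> \<xi> / 2) (at t0 within T)"
proof -
  obtain Q \<xi> where Q: "dx q \<xi> = v" "Q t0 = q" "(Q has_vector_derivative \<xi>) (at t0 within T)"
    "\<forall>\<^sub>F s in at t0 within T. Q s \<in> U \<and> x (Q s) = c s"
    using curve_lift[OF T c] by blast
  define P where "P s = (Q s - q) /\<^sub>R (s - t0)" for s
  have P_lim: "(P \<longlongrightarrow> \<xi>) (at t0 within T)"
  proof (rule LIM_zero_cancel, rule tendsto_norm_zero_cancel)
    have lim: "((\<lambda>s. norm ((1 / norm (s - t0)) *\<^sub>R (Q s - (Q t0 + (s - t0) *\<^sub>R \<xi>)))) \<longlongrightarrow> 0) (at t0 within T)"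
      by (rule tendsto_norm_zero) (use Q(3) in \<open>simp only: has_vector_derivative_def has_derivative_within\<close>)
    have eq: "norm ((1 / norm (s - t0)) *\<^sub>R (Q s - (Q t0 + (s - t0) *\<^sub>R \<xi>))) = norm (P s - \<xi>)"
      if "s \<noteq> t0" for s
    proof -
      have "P s - \<xi> = (1 / (s - t0)) *\<^sub>R (Q s - (Q t0 + (s - t0) *\<^sub>R \<xi>))"
        using that by (simp add: P_def Q(2) divide_inverse scaleR_right_diff_distrib scaleR_add_right)
      then show ?thesis by simp
    qed
    have ev: "\<forall>\<^sub>F s in at t0 within T.
        norm ((1 / norm (s - t0)) *\<^sub>R (Q s - (Q t0 + (s - t0) *\<^sub>R \<xi>))) = norm (P s - \<xi>)"
      unfolding eventually_at_filter by (rule always_eventually) (use eq in blast)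
    show "((\<lambda>s. norm (P s - \<xi>)) \<longlongrightarrow> 0) (at t0 within T)"
      by (rule Lim_transform_eventually[OF lim ev])
  qed
  have Q_lim: "((\<lambda>s. Q s - q) \<longlongrightarrow> 0) (at t0 within T)"
    using has_vector_derivative_continuous[OF Q(3)] Q(2) by (simp add: continuous_within LIM_zero_iff)
  have lin: "linear (\<lambda>v. II n v w)" for w
    using second_derivative.linear_left[OF second_derivative] .
  have "bounded_bilinear (II n)"
    using lin second_form_linear bilinear_conv_bounded_bilinear[of "II n"] by (auto simp: bilinear_def)
  from bounded_bilinear.tendsto[OF this P_lim P_lim]
  have "((\<lambda>s. II n (P s) (P s) / 2) \<longlongrightarrow> II n \<xi> \<xi> / 2) (at t0 within T)"
    by (intro tendsto_divide) auto
  moreover have "((\<lambda>s. n \<bullet> (c s - c t0) / (s - t0)\<^sup>2 - II n (P s) (P s) / 2) \<longlongrightarrow> 0) (at t0 within T)"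
  proof (rule tendstoI)
    fix e :: real assume "e > 0"
    \<comment> \<open>Near t0 \<open>norm (P s)\<close> is below \<open>norm \<xi> + 1\<close>, so
      this tolerance leaves an error of at most e/2.\<close>
    define e' where "e' = e / (2 * (norm \<xi> + 1)\<^sup>2)"
    have pos: "norm \<xi> + 1 > 0" by (simp add: add_nonneg_pos)
    have "e' > 0" using \<open>e > 0\<close> pos by (simp add: e'_def)
    obtain d where d: "d > 0"
      "\<And>\<eta>. norm \<eta> < d \<Longrightarrow> \<bar>n \<bullet> x (q + \<eta>) - n \<bullet> x q - n \<bullet> dx q \<eta> - II n \<eta> \<eta> / 2\<bar> \<le> e' * (norm \<eta>)\<^sup>2"
      using second_derivative.taylor[OF second_derivative \<open>e' > 0\<close>] by metis
    have "\<forall>\<^sub>F s in at t0 within T. norm (Q s - q) < d"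
      using tendstoD[OF Q_lim \<open>d > 0\<close>] by simp
    moreover have "\<forall>\<^sub>F s in at t0 within T. norm (P s) < norm \<xi> + 1"
      by (rule order_tendstoD[OF tendsto_norm[OF P_lim]]) simp
    moreover have "\<forall>\<^sub>F s in at t0 within T. s \<noteq> t0"
      by (simp add: eventually_at_topological) blast
    ultimately show "\<forall>\<^sub>F s in at t0 within T.
        dist (n \<bullet> (c s - c t0) / (s - t0)\<^sup>2 - II n (P s) (P s) / 2) 0 < e"
      using Q(4)
    proof eventually_elim
      case (elim s)
      have Q_eq: "Q s - q = (s - t0) *\<^sub>R P s" using elim by (simp add: P_def)
      have x_eq: "x (q + (s - t0) *\<^sub>R P s) = c s"
        using elim(4) unfolding Q_eq[symmetric] by simp
      have "\<bar>n \<bullet> (c s - c t0) - (s - t0)\<^sup>2 * (II n (P s) (P s) / 2)\<bar> \<le> e' * (norm (Q s - q))\<^sup>2"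
        using d(2)[OF elim(1)] elim c(2) n
        by (simp add: inner_diff_right Q_eq x_eq second_form_simps power2_eq_square mult.assoc)
      also have "\<dots> = e' * (s - t0)\<^sup>2 * (norm (P s))\<^sup>2"
        by (simp add: Q_eq power_mult_distrib)
      also have "\<dots> \<le> e' * (s - t0)\<^sup>2 * (norm \<xi> + 1)\<^sup>2"
        using elim \<open>e' > 0\<close> by (intro mult_left_mono power_mono) auto
      also have "\<dots> = (s - t0)\<^sup>2 * (e / 2)"
        using pos by (simp add: e'_def)
      finally have "\<bar>n \<bullet> (c s - c t0) - (s - t0)\<^sup>2 * (II n (P s) (P s) / 2)\<bar> / (s - t0)\<^sup>2 \<le> e / 2"
        using elim(3) by (simp add: pos_divide_le_eq mult.commute)
      moreover have "n \<bullet> (c s - c t0) / (s - t0)\<^sup>2 - II n (P s) (P s) / 2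
          = (n \<bullet> (c s - c t0) - (s - t0)\<^sup>2 * (II n (P s) (P s) / 2)) / (s - t0)\<^sup>2"
        using elim(3) by (simp add: field_simps)
      ultimately show ?case
        using \<open>e > 0\<close> by (simp only: dist_real_def diff_0_right abs_divide abs_power2)
    qed
  qed
  ultimately have "((\<lambda>s. n \<bullet> (c s - c t0) / (s - t0)\<^sup>2) \<longlongrightarrow> II n \<xi> \<xi> / 2) (at t0 within T)"
    by (rule Lim_transform)
  then show thesis using that Q(1) by blast
qed

section \<open>Comparison of charts\<close>

lemma chart_subset: "x ` U \<subseteq> S"
  using param openin_subset unfolding local_parametrization_def by fastforce

text \<open>Images of parameter lines are the test curves: they stay in S and realise every vector
  of \<open>range (dx q)\<close> as a velocity.\<close>

lemma straight_curve:
  "open {s. q + s *\<^sub>R \<xi> \<in> U}"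
  "((\<lambda>s. x (q + s *\<^sub>R \<xi>)) has_vector_derivative dx q \<xi>) (at 0 within {s. q + s *\<^sub>R \<xi> \<in> U})"
proof -
  have "open ((\<lambda>s. q + s *\<^sub>R \<xi>) -` U)"
    by (rule open_vimage[OF open_U]) (intro continuous_intros)
  then show "open {s. q + s *\<^sub>R \<xi> \<in> U}" by (simp add: vimage_def)
  have "((\<lambda>s. q + s *\<^sub>R \<xi>) has_vector_derivative \<xi>) (at 0 within {s. q + s *\<^sub>R \<xi> \<in> U})"
    by (auto intro!: derivative_eq_intros)
  from vector_derivative_diff_chain_within[OF this, of x "dx q"]
  show "((\<lambda>s. x (q + s *\<^sub>R \<xi>)) has_vector_derivative dx q \<xi>) (at 0 within {s. q + s *\<^sub>R \<xi> \<in> U})"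
    using has_derivative_at_withinI[OF has_derivative[OF q_in]] by (simp add: o_def)
qed

lemma straight_curve_not_isolated: "at 0 within {s. q + s *\<^sub>R \<xi> \<in> U} \<noteq> bot"
  using at_within_open[OF _ straight_curve(1), of 0] q_in by simp

text \<open>A tangent vector coming from another chart is the velocity of a test curve of that
  chart; lifting this curve to the present chart puts the velocity into
  \<open>range (dx q)\<close>.\<close>

lemma tangent_plane_eq: "tangent_plane S (x q) = range (dx q)"
proof
  show "range (dx q) \<subseteq> tangent_plane S (x q)"
    unfolding tangent_plane_def using param q_in by blast
  show "tangent_plane S (x q) \<subseteq> range (dx q)"
  proof
    fix v assume "v \<in> tangent_plane S (x q)"
    then obtain U' x' q' \<xi>' where
      *: "local_parametrization S U' x'" "q' \<in> U'" "x' q' = x q" "v = frechet_derivative x' (at q') \<xi>'"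
      unfolding tangent_plane_def by blast
    interpret other: chart S U' x' q' using * by unfold_locales
    have "(\<lambda>s. x' (q' + s *\<^sub>R \<xi>')) ` {s. q' + s *\<^sub>R \<xi>' \<in> U'} \<subseteq> S"
      using other.chart_subset by auto
    from curve_lift[OF _ other.straight_curve_not_isolated this _ other.straight_curve(2)]
    show "v \<in> range (dx q)" using * by (metis (mono_tags, lifting) add.right_neutral mem_Collect_eq rangeI scale_zero_left)
  qed
qed

lemma normal_orthogonal: "unit_normal S (x q) n \<Longrightarrow> n \<bullet> dx q \<eta> = 0"
  unfolding unit_normal_def tangent_plane_eq by blast

text \<open>One test curve of the other chart is evaluated by \<open>curve_second_order\<close> in
  both charts. The limits agree, and injectivity of the differentials identifies the velocities of
  the two lifts as \<xi> and \<xi>'.\<close>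

lemma second_form_chart_independent_diag:
  assumes "chart S U' x' q'" "x' q' = x q" and n: "unit_normal S (x q) n"
    and eq: "frechet_derivative x' (at q') \<xi>' = dx q \<xi>"
  shows "chart.II x' q' n \<xi>' \<xi>' = II n \<xi> \<xi>"
proof -
  interpret other: chart S U' x' q' by fact
  define c where "c s = x' (q' + s *\<^sub>R \<xi>')" for s
  define T where "T = {s. q' + s *\<^sub>R \<xi>' \<in> U'}"
  have T: "0 \<in> T" "at 0 within T \<noteq> bot" "c ` T \<subseteq> S" "c 0 = x' q'" "c 0 = x q"
    "(c has_vector_derivative dx q \<xi>) (at 0 within T)"
    using other.q_in other.straight_curve_not_isolated other.chart_subset assms(2)
      other.straight_curve(2)[of \<xi>']
    by (auto simp: T_def c_def[abs_def] eq)
  have n': "unit_normal S (x' q') n" using n assms(2) by simp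
  obtain \<xi>1 where 1: "dx q \<xi>1 = dx q \<xi>"
    "((\<lambda>s. n \<bullet> (c s - c 0) / (s - 0)\<^sup>2) \<longlongrightarrow> II n \<xi>1 \<xi>1 / 2) (at 0 within T)"
    using curve_second_order[OF T(1,2,3,5,6) normal_orthogonal[OF n]] by blast
  obtain \<xi>2 where 2: "other.dx q' \<xi>2 = dx q \<xi>"
    "((\<lambda>s. n \<bullet> (c s - c 0) / (s - 0)\<^sup>2) \<longlongrightarrow> other.II n \<xi>2 \<xi>2 / 2) (at 0 within T)"
    using other.curve_second_order[OF T(1,2,3,4,6) other.normal_orthogonal[OF n']] by blast
  have "\<xi>1 = \<xi>" by (rule injD[OF inj_dx[OF q_in] 1(1)])
  moreover have "\<xi>2 = \<xi>'" by (rule injD[OF other.inj_dx[OF other.q_in]]) (simp add: 2(1) eq)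
  ultimately show ?thesis
    using tendsto_unique[OF T(2) 1(2) 2(2)] by simp
qed

lemma polarisation: "II n \<xi> \<eta> = (II n (\<xi> + \<eta>) (\<xi> + \<eta>) - II n \<xi> \<xi> - II n \<eta> \<eta>) / 2"
  by (simp add: second_form_simps second_form_commute[of n \<eta> \<xi>])

lemma second_form_chart_independent:
  assumes "chart S U' x' q'" "x' q' = x q" "unit_normal S (x q) n"
    and "frechet_derivative x' (at q') \<xi>' = dx q \<xi>" "frechet_derivative x' (at q') \<eta>' = dx q \<eta>"
  shows "chart.II x' q' n \<xi>' \<eta>' = II n \<xi> \<eta>"
proof -
  interpret other: chart S U' x' q' by fact
  have "other.dx q' (\<xi>' + \<eta>') = dx q (\<xi> + \<eta>)"
    using assms(4,5) by (simp add: linear_add[OF linear_dx[OF q_in]] linear_add[OF other.linear_dx[OF other.q_in]])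
  then show ?thesis
    using second_form_chart_independent_diag[OF assms(1-3), of "\<xi>' + \<eta>'" "\<xi> + \<eta>"]
      second_form_chart_independent_diag[OF assms(1-3,4)] second_form_chart_independent_diag[OF assms(1-3,5)]
    by (simp only: other.polarisation[of n \<xi>' \<eta>'] polarisation[of n \<xi> \<eta>])
qed

section \<open>The Weingarten map in one chart and the principal curvatures\<close>

lemma weingarten_imp:
  assumes "weingarten S (x q) n v w"
  obtains \<xi> where "v = dx q \<xi>" "n \<bullet> w = 0" "\<And>\<eta>. w \<bullet> dx q \<eta> = II n \<xi> \<eta>"
proof -
  obtain U' x' \<nu> q' \<xi>' where
    *: "local_parametrization S U' x'" "q' \<in> U'" "x' q' = x q" "\<nu> differentiable_on U'"
      "\<And>y. y \<in> U' \<Longrightarrow> unit_normal S (x' y) (\<nu> y)" "\<nu> q' = n"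
      "v = frechet_derivative x' (at q') \<xi>'" "w = - frechet_derivative \<nu> (at q') \<xi>'"
    using assms unfolding weingarten_def by blast
  interpret other: chart S U' x' q' using * by unfold_locales
  have n: "unit_normal S (x q) n" using *(3,6) *(5)[OF *(2)] by simp
  have "\<nu> differentiable (at q')"
    using *(2,4) differentiable_on_eq_differentiable_at[OF other.open_U] by blast
  then have \<nu>: "(\<nu> has_derivative frechet_derivative \<nu> (at q')) (at q')"
    by (simp add: frechet_derivative_works)
  \<comment> \<open>Differentiating \<open>\<nu> \<bullet> \<nu> = 1\<close> shows that w is
    orthogonal to n.\<close>
  have "((\<lambda>y. \<nu> y \<bullet> \<nu> y) has_derivative
      (\<lambda>h. \<nu> q' \<bullet> frechet_derivative \<nu> (at q') h + frechet_derivative \<nu> (at q') h \<bullet> \<nu> q')) (at q')"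
    by (rule has_derivative_inner[OF \<nu> \<nu>])
  moreover have "((\<lambda>y. \<nu> y \<bullet> \<nu> y) has_derivative (\<lambda>h. 0)) (at q')"
    by (rule has_derivative_transform_within_open[OF has_derivative_const[of 1] other.open_U *(2)])
      (use *(5) in \<open>simp add: unit_normal_def dot_square_norm\<close>)
  ultimately have "(\<lambda>h. \<nu> q' \<bullet> frechet_derivative \<nu> (at q') h + frechet_derivative \<nu> (at q') h \<bullet> \<nu> q') = (\<lambda>h. 0)"
    by (rule has_derivative_unique)
  from fun_cong[OF this, of \<xi>'] have "n \<bullet> w = 0"
    using *(6,8) by (simp add: inner_commute)
  \<comment> \<open>Differentiating \<open>\<nu> \<bullet> dx \<eta> = 0\<close> moves the
    derivative from \<nu> to dx; the minus sign in \<open>weingarten\<close> makes the result II.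
    This happens in the chart of the witness and is transferred to the present one
    afterwards.\<close>
  have other_form: "w \<bullet> other.dx q' \<eta> = other.II n \<xi>' \<eta>" for \<eta>
  proof -
    have "((\<lambda>y. \<nu> y \<bullet> other.dx y \<eta>) has_derivative
        (\<lambda>h. \<nu> q' \<bullet> frechet_derivative (\<lambda>y. other.dx y \<eta>) (at q') h
          + frechet_derivative \<nu> (at q') h \<bullet> other.dx q' \<eta>)) (at q')"
      by (rule has_derivative_inner[OF \<nu> other.has_derivative_dx])
    moreover have "((\<lambda>y. \<nu> y \<bullet> other.dx y \<eta>) has_derivative (\<lambda>h. 0)) (at q')"
      by (rule has_derivative_transform_within_open[OF has_derivative_const[of 0] other.open_U *(2)])
        (use *(5) chart.normal_orthogonal[OF other.chart_at] in simp)
    ultimately have "(\<lambda>h. \<nu> q' \<bullet> frechet_derivative (\<lambda>y. other.dx y \<eta>) (at q') h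
          + frechet_derivative \<nu> (at q') h \<bullet> other.dx q' \<eta>) = (\<lambda>h. 0)"
      by (rule has_derivative_unique)
    from fun_cong[OF this, of \<xi>'] show ?thesis
      using *(6,8) by (simp add: other.II_def)
  qed
  have same_range: "range (other.dx q') = range (dx q)"
    using other.tangent_plane_eq tangent_plane_eq *(3) by simp
  then obtain \<xi> where \<xi>: "v = dx q \<xi>" using *(7) by blast
  have "w \<bullet> dx q \<eta> = II n \<xi> \<eta>" for \<eta>
  proof -
    obtain \<eta>' where "other.dx q' \<eta>' = dx q \<eta>" using same_range by (metis rangeE rangeI)
    then show ?thesis
      using other_form[of \<eta>'] second_form_chart_independent[OF other.chart_axioms *(3) n] \<xi> *(7) by metis
  qed
  then show thesis using that \<xi> \<open>n \<bullet> w = 0\<close> by blast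
qed

text \<open>Shows that the relation \<open>weingarten\<close> has values, since it asks for a normal
  field on the whole chart domain. The normalised cross product of the coordinate vectors is one,
  and a single global sign adjusts its value at q to n.\<close>

lemma normal_field_exists:
  assumes n: "unit_normal S (x q) n"
  obtains \<nu> where "\<nu> differentiable_on U" "\<And>y. y \<in> U \<Longrightarrow> unit_normal S (x y) (\<nu> y)" "\<nu> q = n"
proof -
  define c where "c y = cross3 (dx y (1, 0)) (dx y (0, 1))" for y
  have dx_eq: "dx y \<eta> = fst \<eta> *\<^sub>R dx y (1, 0) + snd \<eta> *\<^sub>R dx y (0, 1)" if "y \<in> U" for y \<eta>
  proof -
    have "dx y \<eta> = dx y (fst \<eta> *\<^sub>R (1, 0) + snd \<eta> *\<^sub>R (0, 1))" by simp
    then show ?thesis by (simp only: linear_add[OF linear_dx[OF that]] linear_cmul[OF linear_dx[OF that]])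
  qed
  have c_orth: "c y \<bullet> dx y \<eta> = 0" if "y \<in> U" for y \<eta>
    unfolding dx_eq[OF that, of \<eta>] c_def by (simp add: inner_add_right dot_cross_self)
  have c_nonzero: "c y \<noteq> 0" if "y \<in> U" for y
  proof
    assume "c y = 0"
    then have "collinear {0, dx y (1, 0), dx y (0, 1)}" unfolding c_def cross_eq_0 .
    then have "dx y (1, 0) = 0 \<or> (\<exists>k. dx y (0, 1) = k *\<^sub>R dx y (1, 0))"
      by (auto simp: collinear_lemma)
    then have "dx y (1, 0) = dx y 0 \<or> (\<exists>k. dx y (0, 1) = dx y (k *\<^sub>R (1, 0)))"
      using linear_cmul[OF linear_dx[OF that]] linear_0[OF linear_dx[OF that]] by metis
    then show False
      using injD[OF inj_dx[OF that], of "(1, 0)" 0] injD[OF inj_dx[OF that], of "(0, 1)" "k *\<^sub>R (1, 0)" for k]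
      by (auto simp: zero_prod_def)
  qed
  have c_diff: "c differentiable (at y)" if "y \<in> U" for y
  proof -
    interpret bounded_bilinear cross3
      using bilinear_cross bilinear_conv_bounded_bilinear by blast
    show ?thesis
      unfolding c_def[abs_def] using FDERIV[OF chart.has_derivative_dx chart.has_derivative_dx] chart_at[OF that]
      unfolding differentiable_def by blast
  qed
  define \<nu> where "\<nu> y = (sgn (n \<bullet> c q) / norm (c y)) *\<^sub>R c y" for y
  have norm_n: "norm n = 1" using n by (simp add: unit_normal_def)
  have "cross3 n (c q) = 0"
    unfolding c_def Lagrange using normal_orthogonal[OF n] by simp
  then have "cross3 (c q) n = 0" using cross_skew[of "c q" n] by simp
  then obtain k where k: "n = k *\<^sub>R c q"
    using c_nonzero[OF q_in] norm_n unfolding cross_eq_0 collinear_lemma by force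
  then have k_norm: "\<bar>k\<bar> * norm (c q) = 1" using norm_n unfolding k by simp
  then have "k \<noteq> 0" by auto
  have inner_n: "n \<bullet> c q = k * (norm (c q))\<^sup>2"
    by (simp add: k dot_square_norm)
  have sgn_n: "sgn (n \<bullet> c q) = sgn k"
    using c_nonzero[OF q_in] by (simp add: inner_n sgn_mult)
  show thesis
  proof
    have "\<nu> differentiable (at y)" if "y \<in> U" for y
    proof -
      have "(\<lambda>y. norm (c y)) differentiable (at y)"
        using differentiable_compose[OF _ c_diff[OF that], of norm] differentiable_norm_at[OF c_nonzero[OF that]] by simp
      then show ?thesis
        unfolding \<nu>_def[abs_def] using c_diff[OF that] c_nonzero[OF that]
        by (intro differentiable_scaleR differentiable_divide) auto
    qed
    then show "\<nu> differentiable_on U"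
      by (simp add: differentiable_at_imp_differentiable_on)
    show "unit_normal S (x y) (\<nu> y)" if "y \<in> U" for y
      unfolding unit_normal_def chart.tangent_plane_eq[OF chart_at[OF that]]
      using c_orth[OF that] c_nonzero[OF that] \<open>k \<noteq> 0\<close> by (auto simp: \<nu>_def sgn_n abs_sgn_eq)
    have "sgn k / norm (c q) = k"
      using k_norm \<open>k \<noteq> 0\<close> c_nonzero[OF q_in] by (simp add: sgn_real_def field_simps abs_if split: if_splits)
    then show "\<nu> q = n" by (simp add: \<nu>_def sgn_n flip: k)
  qed
qed

text \<open>From right to left, a normal field supplies some image w', and w - w' is both tangent
  and orthogonal to all tangent vectors, hence 0. The shape operator is thus single-valued, and its
  eigenvalue problem becomes one for II.\<close>

lemma weingarten_iff:
  assumes n: "unit_normal S (x q) n"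
  shows "weingarten S (x q) n v w \<longleftrightarrow>
    (\<exists>\<xi>. v = dx q \<xi> \<and> n \<bullet> w = 0 \<and> (\<forall>\<eta>. w \<bullet> dx q \<eta> = II n \<xi> \<eta>))"
proof
  assume "weingarten S (x q) n v w"
  then show "\<exists>\<xi>. v = dx q \<xi> \<and> n \<bullet> w = 0 \<and> (\<forall>\<eta>. w \<bullet> dx q \<eta> = II n \<xi> \<eta>)"
    using weingarten_imp by metis
next
  assume "\<exists>\<xi>. v = dx q \<xi> \<and> n \<bullet> w = 0 \<and> (\<forall>\<eta>. w \<bullet> dx q \<eta> = II n \<xi> \<eta>)"
  then obtain \<xi> where \<xi>: "v = dx q \<xi>" "n \<bullet> w = 0" "\<And>\<eta>. w \<bullet> dx q \<eta> = II n \<xi> \<eta>" by blast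
  obtain \<nu> where \<nu>: "\<nu> differentiable_on U" "\<And>y. y \<in> U \<Longrightarrow> unit_normal S (x y) (\<nu> y)" "\<nu> q = n"
    using normal_field_exists[OF n] by blast
  define w' where "w' = - frechet_derivative \<nu> (at q) \<xi>"
  have w': "weingarten S (x q) n v w'"
    unfolding weingarten_def w'_def \<xi>(1) using \<nu> param q_in by blast
  then obtain \<xi>' where \<xi>': "v = dx q \<xi>'" "n \<bullet> w' = 0" "\<And>\<eta>. w' \<bullet> dx q \<eta> = II n \<xi>' \<eta>"
    using weingarten_imp by metis
  have "\<xi>' = \<xi>" by (rule injD[OF inj_dx[OF q_in]]) (use \<xi>(1) \<xi>'(1) in simp)
  have "n \<noteq> 0" using n by (auto simp: unit_normal_def)
  then have "w - w' \<in> range (dx q)"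
    using range_dx normal_orthogonal[OF n] \<xi>(2) \<xi>'(2) by (simp add: inner_diff_right)
  then obtain \<eta> where "w - w' = dx q \<eta>" by blast
  moreover have "(w - w') \<bullet> dx q \<eta> = 0"
    using \<xi>(3)[of \<eta>] \<xi>'(3)[of \<eta>] \<open>\<xi>' = \<xi>\<close> by (simp add: inner_diff_left)
  ultimately have "(w - w') \<bullet> (w - w') = 0" by metis
  then show "weingarten S (x q) n v w" using w' by simp
qed

text \<open>In the orthonormal basis e, \<open>cross3 n e\<close> the shape operator is the
  symmetric matrix with rows (a, b) and (b, c). Its eigenvalues are m + d and m - d, so maximum and
  minimum have sum a + c and product \<open>a * c - b\<^sup>2\<close>, also for d = 0, where the set
  of eigenvalues is a singleton.\<close>

lemma curvatures:
  assumes n: "unit_normal S (x q) n" and e: "norm e = 1" "dx q \<xi>\<^sub>e = e" "dx q \<xi>\<^sub>h = cross3 n e"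
  defines "a \<equiv> II n \<xi>\<^sub>e \<xi>\<^sub>e" and "b \<equiv> II n \<xi>\<^sub>e \<xi>\<^sub>h" and "c \<equiv> II n \<xi>\<^sub>h \<xi>\<^sub>h"
  shows "mean_curvature S (x q) n = (a + c) / 2" "gauss_curvature S (x q) n = a * c - b\<^sup>2"
proof -
  define h where "h = cross3 n e"
  have lin: "linear (dx q)" by (rule linear_dx[OF q_in])
  have ne: "n \<bullet> e = 0" using normal_orthogonal[OF n, of \<xi>\<^sub>e] e(2) by simp
  have nn: "n \<bullet> n = 1" "norm n = 1" "e \<bullet> e = 1"
    using n e(1) by (simp_all add: unit_normal_def dot_square_norm)
  have eh: "e \<bullet> h = 0" "h \<bullet> h = 1"
    using nn ne by (simp_all add: h_def dot_cross_self dot_cross)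
  have orth: "e \<bullet> n = 0" "h \<bullet> n = 0" "h \<bullet> e = 0"
    using ne by (simp_all add: inner_commute h_def dot_cross_self)
  have b': "II n \<xi>\<^sub>h \<xi>\<^sub>e = b" by (simp add: b_def second_form_commute)
  have dx_comb: "dx q (p *\<^sub>R \<xi>\<^sub>e + r *\<^sub>R \<xi>\<^sub>h) = p *\<^sub>R e + r *\<^sub>R h" for p r
    using e by (simp add: linear_add[OF lin] linear_cmul[OF lin] h_def)
  have comb: "\<exists>p r. \<xi> = p *\<^sub>R \<xi>\<^sub>e + r *\<^sub>R \<xi>\<^sub>h" for \<xi>
  proof -
    define v where "v = dx q \<xi>"
    \<comment> \<open>w is the part of v not spanned by e and h. Orthogonal to n and e, it is
      parallel to their cross product h; orthogonal to h as well, it vanishes.\<close>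
    define w where "w = v - (v \<bullet> e) *\<^sub>R e - (v \<bullet> h) *\<^sub>R h"
    have "n \<bullet> v = 0" unfolding v_def by (rule normal_orthogonal[OF n])
    then have "w \<bullet> n = 0" "w \<bullet> e = 0" "w \<bullet> h = 0"
      using ne nn eh orth by (simp_all add: w_def inner_diff_left inner_commute[of v n])
    then have "cross3 w h = 0" unfolding h_def Lagrange by simp
    with \<open>w \<bullet> h = 0\<close> eh(2) have "w = 0"
      using norm_and_cross_eq_0[of w h] by auto
    then have "dx q \<xi> = dx q ((v \<bullet> e) *\<^sub>R \<xi>\<^sub>e + (v \<bullet> h) *\<^sub>R \<xi>\<^sub>h)"
      unfolding dx_comb by (simp add: w_def v_def algebra_simps)
    from injD[OF inj_dx[OF q_in] this] show ?thesis by blast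
  qed
  have comb_zero: "p *\<^sub>R e + r *\<^sub>R h = 0 \<longleftrightarrow> p = 0 \<and> r = 0" for p r
  proof
    assume 0: "p *\<^sub>R e + r *\<^sub>R h = 0"
    have "(p *\<^sub>R e + r *\<^sub>R h) \<bullet> e = p" "(p *\<^sub>R e + r *\<^sub>R h) \<bullet> h = r"
      using nn eh orth by (simp_all add: inner_add_left)
    with 0 show "p = 0 \<and> r = 0" by (metis inner_zero_left)
  qed auto
  have eigen: "k \<in> principal_curvatures S (x q) n \<longleftrightarrow>
      (\<exists>p r. (p \<noteq> 0 \<or> r \<noteq> 0) \<and> k * p = p * a + r * b \<and> k * r = p * b + r * c)" for k
  proof
    assume "k \<in> principal_curvatures S (x q) n"
    then obtain v \<xi> where v: "v \<noteq> 0" "v = dx q \<xi>" "\<And>\<eta>. (k *\<^sub>R v) \<bullet> dx q \<eta> = II n \<xi> \<eta>"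
      unfolding principal_curvatures_def weingarten_iff[OF n] by blast
    obtain p r where \<xi>: "\<xi> = p *\<^sub>R \<xi>\<^sub>e + r *\<^sub>R \<xi>\<^sub>h" using comb by blast
    have v': "v = p *\<^sub>R e + r *\<^sub>R h" using v(2) dx_comb \<xi> by simp
    have "k * p = p * a + r * b"
      using v(3)[of \<xi>\<^sub>e] nn eh orth
      by (simp add: v' \<xi> e(2) second_form_simps b' a_def inner_add_left)
    moreover have "k * r = p * b + r * c"
      using v(3)[of \<xi>\<^sub>h] nn eh orth
      by (simp add: v' \<xi> e(3) second_form_simps b_def c_def inner_add_left flip: h_def)
    ultimately show "\<exists>p r. (p \<noteq> 0 \<or> r \<noteq> 0) \<and> k * p = p * a + r * b \<and> k * r = p * b + r * c"
      using v(1) v' comb_zero by blast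
  next
    assume "\<exists>p r. (p \<noteq> 0 \<or> r \<noteq> 0) \<and> k * p = p * a + r * b \<and> k * r = p * b + r * c"
    then obtain p r where pr: "p \<noteq> 0 \<or> r \<noteq> 0" "k * p = p * a + r * b" "k * r = p * b + r * c" by blast
    define \<xi> where "\<xi> = p *\<^sub>R \<xi>\<^sub>e + r *\<^sub>R \<xi>\<^sub>h"
    have "dx q \<xi> \<noteq> 0" unfolding \<xi>_def dx_comb comb_zero using pr(1) by simp
    moreover have "(k *\<^sub>R dx q \<xi>) \<bullet> dx q \<eta> = II n \<xi> \<eta>" for \<eta>
    proof -
      obtain p' r' where \<eta>: "\<eta> = p' *\<^sub>R \<xi>\<^sub>e + r' *\<^sub>R \<xi>\<^sub>h" using comb by blast
      have "(k *\<^sub>R dx q \<xi>) \<bullet> dx q \<eta> = k * p * p' + k * r * r'"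
        unfolding \<xi>_def \<eta> dx_comb using nn eh orth
        by (simp add: inner_add_left inner_add_right algebra_simps)
      also have "\<dots> = II n \<xi> \<eta>"
        unfolding pr \<xi>_def \<eta> second_form_simps b' by (simp add: a_def b_def c_def algebra_simps)
      finally show ?thesis .
    qed
    moreover have "n \<bullet> (k *\<^sub>R dx q \<xi>) = 0" using normal_orthogonal[OF n] by simp
    ultimately show "k \<in> principal_curvatures S (x q) n"
      unfolding principal_curvatures_def weingarten_iff[OF n] by blast
  qed
  have char: "k \<in> principal_curvatures S (x q) n \<longleftrightarrow> (k - a) * (k - c) = b\<^sup>2" for k
  proof
    assume "k \<in> principal_curvatures S (x q) n"
    then obtain p r where pr: "p \<noteq> 0 \<or> r \<noteq> 0" "(k - a) * p = b * r" "(k - c) * r = b * p"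
      unfolding eigen by (auto simp: algebra_simps)
    have "((k - a) * (k - c)) * p = b\<^sup>2 * p" "((k - a) * (k - c)) * r = b\<^sup>2 * r"
      using pr(2,3) by algebra+
    with pr(1) show "(k - a) * (k - c) = b\<^sup>2" by auto
  next
    assume k: "(k - a) * (k - c) = b\<^sup>2"
    show "k \<in> principal_curvatures S (x q) n"
    proof (cases "b = 0")
      case True
      then have "k = a \<or> k = c" using k by auto
      then show ?thesis
        unfolding eigen using True by (auto intro: exI[of _ 1] exI[of _ 0])
    next
      case False
      \<comment> \<open>The eigenvector is (b, k - a), nonzero because b is.\<close>
      have "k * b = b * a + (k - a) * b" "k * (k - a) = b * b + (k - a) * c"
        using k by (simp_all add: algebra_simps power2_eq_square)
      with False show ?thesis unfolding eigen by blast
    qed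
  qed
  define m d where "m = (a + c) / 2" and "d = sqrt (((a - c) / 2)\<^sup>2 + b\<^sup>2)"
  have d: "d \<ge> 0" "d\<^sup>2 = ((a - c) / 2)\<^sup>2 + b\<^sup>2" by (simp_all add: d_def)
  have "(k - a) * (k - c) = b\<^sup>2 \<longleftrightarrow> k = m + d \<or> k = m - d" for k
  proof -
    have "(k - a) * (k - c) - b\<^sup>2 = (k - m)\<^sup>2 - d\<^sup>2"
      unfolding d(2) m_def by (simp add: field_simps power2_eq_square)
    then have "(k - a) * (k - c) = b\<^sup>2 \<longleftrightarrow> (k - m)\<^sup>2 = d\<^sup>2" by auto
    also have "\<dots> \<longleftrightarrow> k = m + d \<or> k = m - d" by (auto simp: power2_eq_iff)
    finally show ?thesis .
  qed
  then have "principal_curvatures S (x q) n = {m + d, m - d}"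
    using char by blast
  then have "Max (principal_curvatures S (x q) n) = m + d" "Min (principal_curvatures S (x q) n) = m - d"
    using d(1) by auto
  moreover have "(m + d) * (m - d) = a * c - b\<^sup>2"
  proof -
    have "(m + d) * (m - d) = m\<^sup>2 - d\<^sup>2" by (simp add: algebra_simps power2_eq_square)
    then show ?thesis unfolding d(2) m_def by (simp add: field_simps power2_eq_square)
  qed
  ultimately show "mean_curvature S (x q) n = (a + c) / 2" "gauss_curvature S (x q) n = a * c - b\<^sup>2"
    unfolding mean_curvature_def gauss_curvature_def by (simp_all add: m_def)
qed

text \<open>Differentiating \<open>N s \<bullet> dx (Q s) \<eta> = 0\<close> along the lift Q gives
  the sum of \<open>N' \<bullet> dx q \<eta>\<close> and II as 0. A normal known only along the
  curve therefore determines the row of II for the direction of the curve.\<close>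

lemma second_form_tangent:
  fixes c N :: "real \<Rightarrow> real^3"
  assumes T: "t0 \<in> T" "at t0 within T \<noteq> bot"
    and c: "c ` T \<subseteq> S" "c t0 = x q" "(c has_vector_derivative v) (at t0 within T)"
    and N: "\<And>t. t \<in> T \<Longrightarrow> unit_normal S (c t) (N t)" "(N has_vector_derivative N') (at t0 within T)"
  obtains \<xi> where "dx q \<xi> = v" "\<And>\<eta>. II (N t0) \<xi> \<eta> = - (N' \<bullet> dx q \<eta>)"
proof -
  obtain Q \<xi> where Q: "dx q \<xi> = v" "Q t0 = q" "(Q has_vector_derivative \<xi>) (at t0 within T)"
    "\<forall>\<^sub>F s in at t0 within T. Q s \<in> U \<and> x (Q s) = c s"
    using curve_lift[OF T c] by blast
  have "II (N t0) \<xi> \<eta> = - (N' \<bullet> dx q \<eta>)" for \<eta>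
  proof -
    have "((\<lambda>s. dx (Q s) \<eta>) has_vector_derivative frechet_derivative (\<lambda>y. dx y \<eta>) (at q) \<xi>) (at t0 within T)"
      using vector_derivative_diff_chain_within[OF Q(3), of "\<lambda>y. dx y \<eta>"]
        has_derivative_at_withinI[OF has_derivative_dx] by (simp add: Q(2) o_def)
    from bounded_bilinear.has_vector_derivative[OF bounded_bilinear_inner N(2) this]
    have deriv: "((\<lambda>s. N s \<bullet> dx (Q s) \<eta>) has_vector_derivative
        II (N t0) \<xi> \<eta> + N' \<bullet> dx q \<eta>) (at t0 within T)"
      by (simp add: II_def Q(2))
    have in_T: "\<forall>\<^sub>F s in at t0 within T. s \<in> T"
      by (simp add: eventually_at_topological) blast
    have zero: "N s \<bullet> dx (Q s) \<eta> = 0" if "(Q s \<in> U \<and> x (Q s) = c s) \<and> s \<in> T" for s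
      using chart.normal_orthogonal[OF chart_at, of "Q s" "N s" \<eta>] N(1)[of s] that by simp
    have ev: "\<forall>\<^sub>F s in at t0 within T. N s \<bullet> dx (Q s) \<eta> = 0"
      by (rule eventually_mono[OF eventually_conj[OF Q(4) in_T] zero])
    have at_t0: "N t0 \<bullet> dx (Q t0) \<eta> = 0"
      using normal_orthogonal N(1)[OF T(1)] c(2) Q(2) by simp
    have "((\<lambda>s. 0) has_vector_derivative II (N t0) \<xi> \<eta> + N' \<bullet> dx q \<eta>) (at t0 within T)"
      unfolding has_vector_derivative_def
      by (rule has_derivative_transform_eventually[OF deriv[unfolded has_vector_derivative_def] ev at_t0 T(1)])
    then have "II (N t0) \<xi> \<eta> + N' \<bullet> dx q \<eta> = 0"
      using vector_derivative_unique_within[OF T(2)] has_vector_derivative_const by blast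
    then show ?thesis by simp
  qed
  then show thesis using that Q(1) by blast
qed

text \<open>For this curve \<open>n \<bullet> (c u - c 0)\<close> is g u itself, and the vanishing
  derivative of g makes b the velocity; the limit of \<open>curve_second_order\<close> then reads
  off II.\<close>

lemma second_form_graph:
  assumes T: "0 \<in> T" "at 0 within T \<noteq> bot" and n: "unit_normal S (x q) n" "n \<bullet> b = 0"
    and g: "\<And>u. u \<in> T \<Longrightarrow> x q + u *\<^sub>R b + g u *\<^sub>R n \<in> S" "g 0 = 0"
      "(g has_vector_derivative 0) (at 0 within T)"
      "((\<lambda>u. g u / u\<^sup>2) \<longlongrightarrow> k / 2) (at 0 within T)"
  obtains \<xi> where "dx q \<xi> = b" "II n \<xi> \<xi> = k"
proof -
  define c where "c u = x q + u *\<^sub>R b + g u *\<^sub>R n" for u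
  have c: "c ` T \<subseteq> S" "c 0 = x q" using g(1,2) by (auto simp: c_def)
  have c': "(c has_vector_derivative b) (at 0 within T)"
    unfolding c_def[abs_def] using g(3)
    by (auto intro!: derivative_eq_intros simp: has_real_derivative_iff_has_vector_derivative)
  obtain \<xi> where \<xi>: "dx q \<xi> = b"
    "((\<lambda>u. n \<bullet> (c u - c 0) / (u - 0)\<^sup>2) \<longlongrightarrow> II n \<xi> \<xi> / 2) (at 0 within T)"
    by (rule curve_second_order[OF T c c' normal_orthogonal[OF n(1)]])
  have "n \<bullet> (c u - c 0) / (u - 0)\<^sup>2 = g u / u\<^sup>2" for u
    using n g(2) by (simp add: c_def inner_add_right dot_square_norm unit_normal_def)
  then have "((\<lambda>u. n \<bullet> (c u - c 0) / (u - 0)\<^sup>2) \<longlongrightarrow> k / 2) (at 0 within T)"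
    using g(4) by (simp only:)
  with \<xi>(2) have "II n \<xi> \<xi> / 2 = k / 2"
    by (rule tendsto_unique[OF T(2)])
  then show thesis using that \<xi>(1) by simp
qed

end

text \<open>Here c stands for II(h, h) and k for II(\<beta>, \<beta>); the second assumption is the
  expansion of k in the frame. The root is \<open>\<bar>\<tau>\<bar>\<close>, so the term inside the
  absolute value becomes \<open>\<kappa> * c - \<tau>\<^sup>2\<close>; one factor \<kappa> joins it
  to form \<open>k * \<rho>\<close>, and one power of \<rho> cancels.\<close>

lemma density_algebra:
  fixes \<kappa> \<tau> c k :: real
  assumes "\<kappa> \<noteq> 0" "k * (\<kappa>\<^sup>2 + \<tau>\<^sup>2) = \<kappa> * (\<kappa> * c - \<tau>\<^sup>2)"
  shows "goodness_density ((\<kappa> + c) / 2) (\<kappa> * c - \<tau>\<^sup>2) \<kappa> \<bar>\<tau>\<bar> = \<bar>k * (\<kappa> / sqrt (\<kappa>\<^sup>2 + \<tau>\<^sup>2))\<bar>"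
proof -
  define \<rho> where "\<rho> = \<kappa>\<^sup>2 + \<tau>\<^sup>2"
  have "\<rho> > 0" using assms(1) unfolding \<rho>_def by (simp add: add_pos_nonneg)
  have "\<rho> powr (3/2) = \<rho> powr (1 + 1/2)" by simp
  also have "\<dots> = \<rho> * sqrt \<rho>"
    using \<open>\<rho> > 0\<close> unfolding powr_add by (simp add: powr_half_sqrt)
  finally have powr: "\<rho> powr (3/2) = \<rho> * sqrt \<rho>" .
  have root: "2 * ((\<kappa> + c) / 2) * \<kappa> - (\<kappa> * c - \<tau>\<^sup>2) - \<kappa>\<^sup>2 = \<tau>\<^sup>2"
    by (simp add: algebra_simps power2_eq_square)
  have num: "\<tau>\<^sup>2 - \<kappa>\<^sup>2 + 2 * ((\<kappa> + c) / 2) * \<kappa> - 2 * \<bar>\<tau>\<bar> * \<bar>\<tau>\<bar> = \<kappa> * c - \<tau>\<^sup>2"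
    unfolding mult.assoc[of 2 "\<bar>\<tau>\<bar>"] abs_mult_self_eq by (simp add: algebra_simps power2_eq_square)
  have "goodness_density ((\<kappa> + c) / 2) (\<kappa> * c - \<tau>\<^sup>2) \<kappa> \<bar>\<tau>\<bar> = \<kappa>\<^sup>2 / (\<rho> * sqrt \<rho>) * \<bar>\<kappa> * c - \<tau>\<^sup>2\<bar>"
    unfolding goodness_density_def root power2_abs real_sqrt_abs \<rho>_def[symmetric] powr num ..
  also have "\<dots> = \<bar>\<kappa>\<bar> * \<bar>\<kappa> * (\<kappa> * c - \<tau>\<^sup>2)\<bar> / (\<rho> * sqrt \<rho>)"
    by (simp add: abs_mult power2_eq_square)
  also have "\<dots> = \<bar>k * (\<kappa> / sqrt \<rho>)\<bar>"
    unfolding assms(2)[symmetric] \<rho>_def[symmetric] using \<open>\<rho> > 0\<close> by (simp add: abs_mult)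
  finally show ?thesis unfolding \<rho>_def .
qed

lemma normal_orthogonal_velocity:
  fixes c :: "real \<Rightarrow> real^3"
  assumes "regular_surface S" and T: "t0 \<in> T" "at t0 within T \<noteq> bot"
    and c: "c ` T \<subseteq> S" "(c has_vector_derivative v) (at t0 within T)"
    and n: "unit_normal S (c t0) n"
  shows "n \<bullet> v = 0"
proof -
  obtain U x q where x: "local_parametrization S U x" "q \<in> U" "c t0 = x q"
    using assms(1) c(1) T(1) unfolding regular_surface_def by (metis image_iff image_subset_iff)
  interpret chart S U x q using x by unfold_locales
  show ?thesis
    using curve_lift[OF T c(1) x(3) c(2)] normal_orthogonal[OF n[unfolded x(3)]] by metis
qed

text \<open>T is the parameter interval of the curve, V that of the ruling through c t0. With c' =
  II(h, h), expanding II at \<beta> gives (\<kappa>^2 c' - 2 \<kappa> \<tau>^2 + \<tau>^2 \<kappa>)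
  / \<rho> = \<kappa> (\<kappa> c' - \<tau>^2) / \<rho>; by the graph the same number is k, twice
  the quadratic coefficient of g.\<close>

lemma density_at_point:
  fixes c N :: "real \<Rightarrow> real^3"
  assumes S: "regular_surface S"
    and T: "t0 \<in> T" "at t0 within T \<noteq> bot"
    and c: "c ` T \<subseteq> S" "(c has_vector_derivative e) (at t0 within T)" "norm e = 1"
    and N: "\<And>t. t \<in> T \<Longrightarrow> unit_normal S (c t) (N t)"
      "(N has_vector_derivative - \<kappa> *\<^sub>R e - \<tau> *\<^sub>R cross3 (N t0) e) (at t0 within T)"
    and \<kappa>: "\<kappa> \<noteq> 0"
    and b: "b = (\<kappa> *\<^sub>R cross3 (N t0) e - \<tau> *\<^sub>R e) /\<^sub>R sqrt (\<kappa>\<^sup>2 + \<tau>\<^sup>2)"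
    and V: "0 \<in> V" "at 0 within V \<noteq> bot"
    and g: "\<And>u. u \<in> V \<Longrightarrow> c t0 + u *\<^sub>R b + g u *\<^sub>R N t0 \<in> S" "g 0 = 0"
      "(g has_vector_derivative 0) (at 0 within V)"
      "((\<lambda>u. g u / u\<^sup>2) \<longlongrightarrow> k / 2) (at 0 within V)"
  shows "goodness_density (mean_curvature S (c t0) (N t0)) (gauss_curvature S (c t0) (N t0)) \<kappa> \<bar>\<tau>\<bar>
      = \<bar>k * (\<kappa> / sqrt (\<kappa>\<^sup>2 + \<tau>\<^sup>2))\<bar>"
proof -
  obtain U x q where x: "local_parametrization S U x" "q \<in> U" "x q = c t0"
    using S c(1) T(1) unfolding regular_surface_def by (metis image_iff image_subset_iff)
  interpret chart S U x q using x by unfold_locales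
  define h where "h = cross3 (N t0) e"
  note lin = linear_add[OF linear_dx[OF q_in]] linear_cmul[OF linear_dx[OF q_in]] linear_diff[OF linear_dx[OF q_in]]
  have n: "unit_normal S (x q) (N t0)" using N(1)[OF T(1)] x(3) by simp
  obtain \<xi>\<^sub>e where e: "dx q \<xi>\<^sub>e = e" "\<And>\<eta>. II (N t0) \<xi>\<^sub>e \<eta> = - ((- \<kappa> *\<^sub>R e - \<tau> *\<^sub>R h) \<bullet> dx q \<eta>)"
    using second_form_tangent[OF T c(1) x(3)[symmetric] c(2) N] unfolding h_def by metis
  have ne: "N t0 \<bullet> e = 0" using normal_orthogonal[OF n, of \<xi>\<^sub>e] e(1) by simp
  have nn: "N t0 \<bullet> N t0 = 1" "e \<bullet> e = 1" "N t0 \<noteq> 0"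
    using n c(3) by (auto simp: unit_normal_def dot_square_norm)
  have frame: "e \<bullet> h = 0" "h \<bullet> e = 0" "h \<bullet> h = 1" "N t0 \<bullet> h = 0"
    using nn ne by (simp_all add: h_def dot_cross_self dot_cross)
  have "h \<in> range (dx q)"
    using range_dx[OF nn(3) normal_orthogonal[OF n]] frame by simp
  then obtain \<xi>\<^sub>h where h: "dx q \<xi>\<^sub>h = h" by auto
  have ee: "II (N t0) \<xi>\<^sub>e \<xi>\<^sub>e = \<kappa>" and eh: "II (N t0) \<xi>\<^sub>e \<xi>\<^sub>h = \<tau>"
    using nn frame by (simp_all add: e h inner_diff_left)
  then have he: "II (N t0) \<xi>\<^sub>h \<xi>\<^sub>e = \<tau>" by (simp add: second_form_commute)
  define \<rho> where "\<rho> = \<kappa>\<^sup>2 + \<tau>\<^sup>2"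
  have "\<rho> > 0" using \<kappa> unfolding \<rho>_def by (simp add: add_pos_nonneg)
  have nb: "N t0 \<bullet> b = 0"
    using frame ne unfolding b h_def[symmetric] by (simp add: inner_diff_right)
  obtain \<xi> where \<xi>: "dx q \<xi> = b" "II (N t0) \<xi> \<xi> = k"
    using second_form_graph[OF V n nb g(1,2,3,4)[folded x(3)]] by metis
  have "dx q \<xi> = dx q ((1 / sqrt \<rho>) *\<^sub>R (\<kappa> *\<^sub>R \<xi>\<^sub>h + (- \<tau>) *\<^sub>R \<xi>\<^sub>e))"
    unfolding \<xi>(1) b h_def[symmetric] \<rho>_def lin e h by (simp add: divide_inverse)
  then have "\<xi> = (1 / sqrt \<rho>) *\<^sub>R (\<kappa> *\<^sub>R \<xi>\<^sub>h + (- \<tau>) *\<^sub>R \<xi>\<^sub>e)"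
    by (rule injD[OF inj_dx[OF q_in]])
  then have "k = 1 / sqrt \<rho> * (1 / sqrt \<rho>) * (\<kappa> * (\<kappa> * II (N t0) \<xi>\<^sub>h \<xi>\<^sub>h - \<tau>\<^sup>2))"
    unfolding \<xi>(2)[symmetric] 
    by (simp only: second_form_simps he eh ee) (simp add: algebra_simps power2_eq_square)
  also have "1 / sqrt \<rho> * (1 / sqrt \<rho>) = 1 / \<rho>" using \<open>\<rho> > 0\<close> by simp
  finally have "k * (\<kappa>\<^sup>2 + \<tau>\<^sup>2) = \<kappa> * (\<kappa> * II (N t0) \<xi>\<^sub>h \<xi>\<^sub>h - \<tau>\<^sup>2)"
    using \<open>\<rho> > 0\<close> by (simp add: \<rho>_def)
  note algebra = density_algebra[OF \<kappa> this]
  show "goodness_density (mean_curvature S (c t0) (N t0)) (gauss_curvature S (c t0) (N t0)) \<kappa> \<bar>\<tau>\<bar>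
      = \<bar>k * (\<kappa> / sqrt (\<kappa>\<^sup>2 + \<tau>\<^sup>2))\<bar>"
    using algebra curvatures[OF n c(3) e(1) h[unfolded h_def]] by (simp only: x(3) ee eh)
qed

section \<open>Volume of a thin domain\<close>

lemma iterated_integral_continuous:
  fixes g :: "real \<Rightarrow> real \<Rightarrow> real \<Rightarrow> real"
  assumes "continuous_on ({a..b} \<times> {c..d} \<times> {k..l}) (\<lambda>(t, u, w). g t u w)"
  shows "continuous_on ({a..b} \<times> {c..d}) (\<lambda>(t, u). integral {k..l} (g t u))"
    and "continuous_on {a..b} (\<lambda>t. integral {c..d} (\<lambda>u. integral {k..l} (g t u)))"
proof -
  have "continuous_on (({a..b} \<times> {c..d}) \<times> cbox k l)
      (\<lambda>z. (\<lambda>(t, u, w). g t u w) (fst (fst z), snd (fst z), snd z))"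
    by (rule continuous_on_compose2[OF assms]) (auto intro!: continuous_intros)
  then have "continuous_on (({a..b} \<times> {c..d}) \<times> cbox k l) (\<lambda>(z, w). g (fst z) (snd z) w)"
    by (simp add: split_beta)
  from integral_continuous_on_param[OF this]
  show *: "continuous_on ({a..b} \<times> {c..d}) (\<lambda>(t, u). integral {k..l} (g t u))"
    by (simp add: split_beta)
  from integral_continuous_on_param[OF *[folded cbox_interval[of c d]]]
  show "continuous_on {a..b} (\<lambda>t. integral {c..d} (\<lambda>u. integral {k..l} (g t u)))"
    by simp
qed

lemma integral_diff_bound:
  fixes g h :: "real \<Rightarrow> real"
  assumes "a \<le> b" "continuous_on {a..b} g" "continuous_on {a..b} h"
    "\<And>x. x \<in> {a..b} \<Longrightarrow> \<bar>g x - h x\<bar> \<le> B"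
  shows "\<bar>integral {a..b} g - integral {a..b} h\<bar> \<le> B * (b - a)"
proof -
  have "integral {a..b} g - integral {a..b} h = integral {a..b} (\<lambda>x. g x - h x)"
    using assms(2,3) by (intro integral_diff[symmetric] integrable_continuous_interval)
  then show ?thesis
    using integral_bound[OF assms(1) continuous_on_diff[OF assms(2,3)], of B] assms(4) by simp
qed

lemma integral_square_symmetric:
  fixes c \<epsilon> :: real
  assumes "0 \<le> \<epsilon>"
  shows "integral {-\<epsilon>..\<epsilon>} (\<lambda>u. c * u\<^sup>2) = 2 / 3 * c * \<epsilon>^3"
proof -
  have *: "((\<lambda>u. c * u\<^sup>2) has_integral (c * \<epsilon>^3 / 3 - c * (-\<epsilon>)^3 / 3)) {-\<epsilon>..\<epsilon>}"
    using assms
    by (intro fundamental_theorem_of_calculus)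
      (auto intro!: derivative_eq_intros simp flip: has_real_derivative_iff_has_vector_derivative)
  show ?thesis unfolding integral_unique[OF *] by simp
qed

text \<open>With F = k u^2 / 2 + O(u^3) and a bracket a + O(u), the integrand is
  \<open>\<bar>k t * a t\<bar> / 2 * u\<^sup>2\<close> up to \<open>E * \<epsilon>^3\<close>,
  uniformly in t and w. Integrating the main term over u gives \<epsilon>^3 / 3 times its
  coefficient \<open>\<bar>k t * a t\<bar>\<close>, and the error gains the length 2 \<epsilon>,
  hence the fourth power and the constant \<open>2 * E * \<alpha>\<close>.\<close>

lemma thin_domain_volume:
  fixes F :: "real \<times> real \<Rightarrow> real" and a p r k :: "real \<Rightarrow> real"
  assumes "0 \<le> \<alpha>" "0 < \<epsilon>0"
    and F: "continuous_on ({0..\<alpha>} \<times> {-\<epsilon>0..\<epsilon>0}) F"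
    and cont: "continuous_on {0..\<alpha>} a" "continuous_on {0..\<alpha>} p"
      "continuous_on {0..\<alpha>} r" "continuous_on {0..\<alpha>} k"
    and F_est: "\<And>t u. t \<in> {0..\<alpha>} \<Longrightarrow> u \<in> {-\<epsilon>0..\<epsilon>0} \<Longrightarrow> \<bar>F (t, u) - k t / 2 * u\<^sup>2\<bar> \<le> C * \<bar>u\<bar>^3"
  obtains D where "\<And>\<epsilon>. 0 < \<epsilon> \<Longrightarrow> \<epsilon> \<le> \<epsilon>0 \<Longrightarrow>
    \<bar>integral {0..\<alpha>} (\<lambda>t. integral {-\<epsilon>..\<epsilon>} (\<lambda>u. integral {0..1} (\<lambda>w.
        \<bar>F (t, u) * (a t + u * p t + w * F (t, u) * r t)\<bar>)))
      - 1/3 * \<epsilon>^3 * integral {0..\<alpha>} (\<lambda>t. \<bar>k t * a t\<bar>)\<bar> \<le> D * \<epsilon>^4"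
proof -
  have "\<exists>B. \<forall>t\<in>{0..\<alpha>}. \<bar>g t\<bar> \<le> B" if "continuous_on {0..\<alpha>} g" for g :: "real \<Rightarrow> real"
    using compact_imp_bounded[OF compact_continuous_image[OF that compact_Icc]]
    by (auto simp: bounded_iff)
  then obtain Ba Bp Br Bk where B': "\<And>t. t \<in> {0..\<alpha>} \<Longrightarrow> \<bar>a t\<bar> \<le> Ba" "\<And>t. t \<in> {0..\<alpha>} \<Longrightarrow> \<bar>p t\<bar> \<le> Bp"
    "\<And>t. t \<in> {0..\<alpha>} \<Longrightarrow> \<bar>r t\<bar> \<le> Br" "\<And>t. t \<in> {0..\<alpha>} \<Longrightarrow> \<bar>k t\<bar> \<le> Bk"
    using cont by metis
  define B where "B = max (max Ba Bp) (max (max Br Bk) 0)"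
  have B: "\<bar>a t\<bar> \<le> B" "\<bar>p t\<bar> \<le> B" "\<bar>r t\<bar> \<le> B" "\<bar>k t\<bar> \<le> B" if "t \<in> {0..\<alpha>}" for t
    using B'[OF that] by (auto simp: B_def)
  have "B \<ge> 0" by (simp add: B_def)
  define C' where "C' = max C 0"
  \<comment> \<open>L bounds F by \<open>L * u\<^sup>2\<close>. In E the first summand pays for
    replacing F by its quadratic part, the second for dropping the terms with p and r from the
    bracket.\<close>
  define L where "L = B / 2 + C' * \<epsilon>0"
  define E where "E = C' * B + L * (B + L * \<epsilon>0 * B)"
  have "C' \<ge> 0" "L \<ge> 0" using \<open>B \<ge> 0\<close> \<open>0 < \<epsilon>0\<close> by (simp_all add: C'_def L_def)
  have pointwise: "\<bar>\<bar>F (t, u) * (a t + u * p t + w * F (t, u) * r t)\<bar> - \<bar>k t * a t\<bar> / 2 * u\<^sup>2\<bar> \<le> E * \<epsilon>^3"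
    if "t \<in> {0..\<alpha>}" "\<bar>u\<bar> \<le> \<epsilon>" "w \<in> {0..1}" "0 < \<epsilon>" "\<epsilon> \<le> \<epsilon>0" for t u w \<epsilon>
  proof -
    have u: "u \<in> {-\<epsilon>0..\<epsilon>0}" "\<bar>u\<bar> \<le> \<epsilon>0" using that by auto
    have est: "\<bar>F (t, u) - k t / 2 * u\<^sup>2\<bar> \<le> C' * \<bar>u\<bar>^3"
      using F_est[OF that(1) u(1)] mult_right_mono[of C C' "\<bar>u\<bar>^3"] by (simp add: C'_def)
    have cube: "\<bar>u\<bar>^3 = u\<^sup>2 * \<bar>u\<bar>" 
      by (simp only: power3_eq_cube power2_abs[of u, symmetric] power2_eq_square[of "\<bar>u\<bar>"])
    have "\<bar>F (t, u)\<bar> \<le> \<bar>k t / 2 * u\<^sup>2\<bar> + C' * \<bar>u\<bar>^3" using est by linarith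
    also have "\<dots> \<le> B / 2 * u\<^sup>2 + C' * (u\<^sup>2 * \<epsilon>0)"
      unfolding cube abs_mult using B[OF that(1)] u(2) \<open>C' \<ge> 0\<close>
      by (intro add_mono mult_mono mult_left_mono) auto
    also have "\<dots> = L * u\<^sup>2" by (simp add: L_def algebra_simps)
    finally have F_bound: "\<bar>F (t, u)\<bar> \<le> L * u\<^sup>2" .
    have inner: "\<bar>u * p t + w * F (t, u) * r t\<bar> \<le> \<bar>u\<bar> * (B + L * \<epsilon>0 * B)"
    proof -
      have "\<bar>w * F (t, u) * r t\<bar> \<le> 1 * (L * u\<^sup>2) * B"
        unfolding abs_mult using that(3) F_bound B[OF that(1)] \<open>L \<ge> 0\<close>
        by (intro mult_mono) auto
      also have "\<dots> = L * \<bar>u\<bar> * \<bar>u\<bar> * B" by (simp add: power2_eq_square)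
      also have "\<dots> \<le> L * \<bar>u\<bar> * \<epsilon>0 * B"
        using u(2) \<open>L \<ge> 0\<close> \<open>B \<ge> 0\<close> by (intro mult_right_mono mult_left_mono) auto
      finally have "\<bar>w * F (t, u) * r t\<bar> \<le> L * \<bar>u\<bar> * \<epsilon>0 * B" .
      moreover have "\<bar>u * p t\<bar> \<le> \<bar>u\<bar> * B"
        unfolding abs_mult using B[OF that(1)] by (intro mult_left_mono) auto
      ultimately show ?thesis by (simp add: algebra_simps)
    qed
    have "\<bar>\<bar>F (t, u) * (a t + u * p t + w * F (t, u) * r t)\<bar> - \<bar>k t * a t\<bar> / 2 * u\<^sup>2\<bar>
        = \<bar>\<bar>F (t, u) * (a t + u * p t + w * F (t, u) * r t)\<bar> - \<bar>k t / 2 * u\<^sup>2 * a t\<bar>\<bar>"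
      by (simp add: abs_mult mult_ac)
    also have "\<dots> \<le> \<bar>F (t, u) * (a t + u * p t + w * F (t, u) * r t) - k t / 2 * u\<^sup>2 * a t\<bar>"
      by (rule abs_triangle_ineq3)
    also have "\<dots> = \<bar>(F (t, u) - k t / 2 * u\<^sup>2) * a t + F (t, u) * (u * p t + w * F (t, u) * r t)\<bar>"
      by (simp add: algebra_simps)
    also have "\<dots> \<le> \<bar>F (t, u) - k t / 2 * u\<^sup>2\<bar> * \<bar>a t\<bar> + \<bar>F (t, u)\<bar> * \<bar>u * p t + w * F (t, u) * r t\<bar>"
      unfolding abs_mult[symmetric] by (rule abs_triangle_ineq)
    also have "\<dots> \<le> C' * \<bar>u\<bar>^3 * B + L * u\<^sup>2 * (\<bar>u\<bar> * (B + L * \<epsilon>0 * B))"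
      by (intro add_mono mult_mono est F_bound inner B[OF that(1)])
        (use \<open>C' \<ge> 0\<close> \<open>L \<ge> 0\<close> in simp_all)
    also have "\<dots> = E * \<bar>u\<bar>^3" unfolding cube E_def by (simp add: algebra_simps)
    also have "\<dots> \<le> E * \<epsilon>^3"
      using that(2) \<open>B \<ge> 0\<close> \<open>C' \<ge> 0\<close> \<open>L \<ge> 0\<close> \<open>0 < \<epsilon>0\<close> unfolding E_def
      by (intro mult_left_mono power_mono) auto
    finally show ?thesis .
  qed
  show thesis
  proof
    fix \<epsilon> :: real assume \<epsilon>: "0 < \<epsilon>" "\<epsilon> \<le> \<epsilon>0"
    define g where "g t u w = \<bar>F (t, u) * (a t + u * p t + w * F (t, u) * r t)\<bar>" for t u w
    have F': "continuous_on ({0..\<alpha>} \<times> {-\<epsilon>..\<epsilon>} \<times> {0..1}) (\<lambda>z. F (fst z, fst (snd z)))"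
      by (rule continuous_on_compose2[OF F]) (use \<epsilon> in \<open>auto intro!: continuous_intros\<close>)
    have comp: "continuous_on ({0..\<alpha>} \<times> {-\<epsilon>..\<epsilon>} \<times> {0..1::real}) (\<lambda>z. h (fst z))"
      if "continuous_on {0..\<alpha>} h" for h :: "real \<Rightarrow> real"
      by (rule continuous_on_compose2[OF that]) (auto intro!: continuous_intros)
    have g_cont: "continuous_on ({0..\<alpha>} \<times> {-\<epsilon>..\<epsilon>} \<times> {0..1}) (\<lambda>(t, u, w). g t u w)"
      unfolding g_def split_beta by (intro continuous_intros F' comp cont)
    have g_w: "continuous_on {0..1} (g t u)" if "t \<in> {0..\<alpha>}" "u \<in> {-\<epsilon>..\<epsilon>}" for t u
      unfolding g_def by (intro continuous_intros)
    have g_u: "continuous_on {-\<epsilon>..\<epsilon>} (\<lambda>u. integral {0..1} (g t u))" if "t \<in> {0..\<alpha>}" for t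
      by (rule continuous_on_compose2[OF iterated_integral_continuous(1)[OF g_cont], of _ "Pair t", simplified split_beta fst_conv snd_conv])
        (use that in \<open>auto intro!: continuous_intros\<close>)
    have w_est: "\<bar>integral {0..1} (g t u) - \<bar>k t * a t\<bar> / 2 * u\<^sup>2\<bar> \<le> E * \<epsilon>^3"
      if "t \<in> {0..\<alpha>}" "u \<in> {-\<epsilon>..\<epsilon>}" for t u
      using integral_diff_bound[of 0 1 "g t u" "\<lambda>w. \<bar>k t * a t\<bar> / 2 * u\<^sup>2" "E * \<epsilon>^3"] g_w[OF that]
        pointwise[OF that(1) _ _ \<epsilon>, of u] that(2)
      by (simp add: g_def abs_le_iff)
    have u_est: "\<bar>integral {-\<epsilon>..\<epsilon>} (\<lambda>u. integral {0..1} (g t u)) - 1/3 * \<epsilon>^3 * \<bar>k t * a t\<bar>\<bar> \<le> 2 * E * \<epsilon>^4"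
      if "t \<in> {0..\<alpha>}" for t
    proof -
      have "\<bar>integral {-\<epsilon>..\<epsilon>} (\<lambda>u. integral {0..1} (g t u)) - integral {-\<epsilon>..\<epsilon>} (\<lambda>u. \<bar>k t * a t\<bar> / 2 * u\<^sup>2)\<bar>
          \<le> E * \<epsilon>^3 * (\<epsilon> - (-\<epsilon>))"
        using \<epsilon> by (intro integral_diff_bound g_u that w_est continuous_intros) auto
      moreover have "integral {-\<epsilon>..\<epsilon>} (\<lambda>u. \<bar>k t * a t\<bar> / 2 * u\<^sup>2) = 1/3 * \<epsilon>^3 * \<bar>k t * a t\<bar>"
        using integral_square_symmetric[of \<epsilon> "\<bar>k t * a t\<bar> / 2"] \<epsilon> by simp
      moreover have "E * \<epsilon>^3 * (\<epsilon> - (-\<epsilon>)) = 2 * E * \<epsilon>^4"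
        by (simp add: power4_eq_xxxx power3_eq_cube)
      ultimately show ?thesis by (simp only:)
    qed
    have "\<bar>integral {0..\<alpha>} (\<lambda>t. integral {-\<epsilon>..\<epsilon>} (\<lambda>u. integral {0..1} (g t u)))
        - integral {0..\<alpha>} (\<lambda>t. 1/3 * \<epsilon>^3 * \<bar>k t * a t\<bar>)\<bar> \<le> 2 * E * \<epsilon>^4 * (\<alpha> - 0)"
      by (intro integral_diff_bound u_est iterated_integral_continuous(2)[OF g_cont] continuous_intros cont assms(1))
    then show "\<bar>integral {0..\<alpha>} (\<lambda>t. integral {-\<epsilon>..\<epsilon>} (\<lambda>u. integral {0..1} (\<lambda>w.
        \<bar>F (t, u) * (a t + u * p t + w * F (t, u) * r t)\<bar>)))
      - 1/3 * \<epsilon>^3 * integral {0..\<alpha>} (\<lambda>t. \<bar>k t * a t\<bar>)\<bar> \<le> 2 * E * \<alpha> * \<epsilon>^4"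
      unfolding g_def by (simp add: mult_ac)
  qed
qed

section \<open>Smooth extensions and the expansion of the goodness\<close>

text \<open>A single extension is differentiated repeatedly, so every \<open>P n\<close> has full
  derivatives at the points of A, boundary points included. Outside A nothing is claimed, as
  \<open>frechet_derivative\<close> may be an arbitrary value there.\<close>

lemma smooth_on_iterated_derivative:
  fixes f :: "'a::euclidean_space \<Rightarrow> 'b::real_normed_vector" and v :: 'a
  assumes "smooth_on A f"
  obtains P where "\<And>x. x \<in> A \<Longrightarrow> P 0 x = f x" "\<And>n x. x \<in> A \<Longrightarrow> P n differentiable (at x)"
    "\<And>n x. P (Suc n) x = frechet_derivative (P n) (at x) v"
proof -
  obtain U g where U: "A \<subseteq> U" "\<And>n. C_k n U g" "\<And>x. x \<in> A \<Longrightarrow> g x = f x"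
    using assms unfolding smooth_on_def by blast
  define P where "P = rec_nat g (\<lambda>_ h x. frechet_derivative h (at x) v)"
  have P: "P 0 = g" "\<And>n x. P (Suc n) x = frechet_derivative (P n) (at x) v"
    by (simp_all add: P_def)
  have "C_k n U (P m)" for m n
  proof (induction m arbitrary: n)
    case 0
    show ?case using U(2) P(1) by simp
  next
    case (Suc m)
    have "C_k n U (\<lambda>x. frechet_derivative (P m) (at x) v)"
      using Suc[of "Suc n"] by simp
    then show ?case using P(2) by presburger
  qed
  then have "P n differentiable (at x)" if "x \<in> A" for n x
    using that U(1) C_k.simps(2)[of 0 U "P n"] by blast
  with P U(3) show thesis by (intro that[of P]) simp_all
qed

lemma smooth_curve_iterated_derivative:
  fixes c :: "real \<Rightarrow> 'b::real_normed_vector"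
  assumes "smooth_on A c"
  obtains P where "\<And>t. t \<in> A \<Longrightarrow> P 0 t = c t"
    "\<And>n t. t \<in> A \<Longrightarrow> (P n has_vector_derivative P (Suc n) t) (at t)"
proof -
  obtain P where P: "\<And>x. x \<in> A \<Longrightarrow> P 0 x = c x" "\<And>n x. x \<in> A \<Longrightarrow> P n differentiable (at x)"
    "\<And>n x. P (Suc n) x = frechet_derivative (P n) (at x) 1"
    using smooth_on_iterated_derivative[OF assms, of 1] by metis
  have "(P n has_vector_derivative P (Suc n) t) (at t)" if "t \<in> A" for n t
  proof -
    have "(P n has_derivative frechet_derivative (P n) (at t)) (at t)"
      using P(2)[OF that] frechet_derivative_works by blast
    moreover from has_derivative_linear[OF this] have "frechet_derivative (P n) (at t) h = h *\<^sub>R P (Suc n) t" for h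
      using linear_cmul[of "frechet_derivative (P n) (at t)" h 1] by (simp add: P(3))
    ultimately show ?thesis unfolding has_vector_derivative_def by (metis ext)
  qed
  then show thesis using that P(1) by blast
qed

text \<open>Maclaurin's formula in u for each fixed t: k t is the second u-derivative at (t, 0), and
  C is a bound of the third one on the compact rectangle, divided by 3!, hence uniform in t.\<close>

lemma height_expansion:
  fixes f :: "real \<times> real \<Rightarrow> real"
  assumes f: "smooth_on ({a..b} \<times> {-\<epsilon>0..\<epsilon>0}) f" "0 < \<epsilon>0"
    and f0: "\<And>t. t \<in> {a..b} \<Longrightarrow> f (t, 0) = 0"
      "\<And>t. t \<in> {a..b} \<Longrightarrow> vector_derivative (\<lambda>u. f (t, u)) (at 0 within {-\<epsilon>0..\<epsilon>0}) = 0"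
  obtains ft fu k C where
    "\<And>t u. t \<in> {a..b} \<Longrightarrow> u \<in> {-\<epsilon>0..\<epsilon>0} \<Longrightarrow>
      ((\<lambda>s. f (s, u)) has_vector_derivative ft t u) (at t within {a..b})"
    "\<And>t u. t \<in> {a..b} \<Longrightarrow> u \<in> {-\<epsilon>0..\<epsilon>0} \<Longrightarrow>
      ((\<lambda>v. f (t, v)) has_vector_derivative fu t u) (at u within {-\<epsilon>0..\<epsilon>0})"
    "\<And>t. t \<in> {a..b} \<Longrightarrow> fu t 0 = 0"
    "continuous_on ({a..b} \<times> {-\<epsilon>0..\<epsilon>0}) f" "continuous_on {a..b} k"
    "\<And>t u. t \<in> {a..b} \<Longrightarrow> u \<in> {-\<epsilon>0..\<epsilon>0} \<Longrightarrow> \<bar>f (t, u) - k t / 2 * u\<^sup>2\<bar> \<le> C * \<bar>u\<bar>^3"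
proof -
  let ?A = "{a..b} \<times> {-\<epsilon>0..\<epsilon>0}"
  obtain P where P: "\<And>x. x \<in> ?A \<Longrightarrow> P 0 x = f x" "\<And>n x. x \<in> ?A \<Longrightarrow> P n differentiable (at x)"
    "\<And>n x. P (Suc n) x = frechet_derivative (P n) (at x) (0, 1)"
    using smooth_on_iterated_derivative[OF f(1), of "(0, 1)"] by metis
  have deriv: "(P n has_derivative frechet_derivative (P n) (at x)) (at x)" if "x \<in> ?A" for n x
    using P(2)[OF that] frechet_derivative_works by blast
  have cont: "continuous_on ?A (P n)" for n
    using differentiable_imp_continuous_on[OF differentiable_at_imp_differentiable_on] P(2) by blast
  define ft where "ft t u = frechet_derivative (P 0) (at (t, u)) (1, 0)" for t u
  have t_deriv: "((\<lambda>s. P 0 (s, u)) has_vector_derivative ft t u) (at t within {a..b})"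
    if "(t, u) \<in> ?A" for t u
  proof -
    have "((\<lambda>s. (s, u)) has_vector_derivative (1, 0)) (at t within {a..b})"
      by (auto intro!: derivative_eq_intros has_vector_derivative_Pair)
    from vector_derivative_diff_chain_within[OF this, of "P 0"] show ?thesis
      using has_derivative_at_withinI[OF deriv[OF that]] by (auto simp: o_def ft_def)
  qed
  have u_deriv: "((\<lambda>v. P n (t, v)) has_real_derivative P (Suc n) (t, u)) (at u)" if "(t, u) \<in> ?A" for n t u
  proof -
    have "((\<lambda>v. (t, v)) has_vector_derivative (0, 1)) (at u)"
      by (auto intro!: derivative_eq_intros has_vector_derivative_Pair)
    from vector_derivative_diff_chain_within[OF this, of "P n"] show ?thesis
      using has_derivative_at_withinI[OF deriv[OF that]]
      by (auto simp: o_def P(3) has_real_derivative_iff_has_vector_derivative)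
  qed
  have f_t: "((\<lambda>s. f (s, u)) has_vector_derivative ft t u) (at t within {a..b})"
    if "t \<in> {a..b}" "u \<in> {-\<epsilon>0..\<epsilon>0}" for t u
    by (rule has_vector_derivative_transform[OF that(1) _ t_deriv]) (use that P(1) in auto)
  have f_u: "((\<lambda>v. f (t, v)) has_vector_derivative P 1 (t, u)) (at u within {-\<epsilon>0..\<epsilon>0})"
    if "t \<in> {a..b}" "u \<in> {-\<epsilon>0..\<epsilon>0}" for t u
  proof (rule has_vector_derivative_transform[OF that(2)])
    show "((\<lambda>v. P 0 (t, v)) has_vector_derivative P 1 (t, u)) (at u within {-\<epsilon>0..\<epsilon>0})"
      using u_deriv[of t u 0] that
      by (auto simp: has_real_derivative_iff_has_vector_derivative intro: has_vector_derivative_at_within)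
  qed (use that P(1) in auto)
  \<comment> \<open>The assumption speaks of \<open>vector_derivative\<close>, a choice that is
    meaningful only where a derivative exists; \<open>f_u\<close> supplies it.\<close>
  have P1: "P 1 (t, 0) = 0" if "t \<in> {a..b}" for t
    using vector_derivative_within_closed_interval[OF _ _ f_u[OF that], of 0] f0(2)[OF that] f(2) by simp
  obtain M where M: "\<And>x. x \<in> ?A \<Longrightarrow> \<bar>P 3 x\<bar> \<le> M"
    using compact_imp_bounded[OF compact_continuous_image[OF cont compact_Times[OF compact_Icc compact_Icc]], of 3]
    unfolding bounded_iff by auto
  have est: "\<bar>f (t, u) - P 2 (t, 0) / 2 * u\<^sup>2\<bar> \<le> M / 6 * \<bar>u\<bar>^3"
    if tu: "t \<in> {a..b}" "u \<in> {-\<epsilon>0..\<epsilon>0}" for t u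
  proof -
    have "\<exists>z. \<bar>z\<bar> \<le> \<bar>u\<bar> \<and> P 0 (t, u)
        = (\<Sum>m<3. P m (t, 0) / fact m * u ^ m) + P 3 (t, z) / fact 3 * u ^ 3"
      by (rule Maclaurin_bi_le[where diff = "\<lambda>m v. P m (t, v)", OF refl])
        (intro allI impI u_deriv, use tu in auto)
    then obtain z where z: "\<bar>z\<bar> \<le> \<bar>u\<bar>" "P 0 (t, u)
        = (\<Sum>m<3. P m (t, 0) / fact m * u ^ m) + P 3 (t, z) / fact 3 * u ^ 3"
      by blast
    have sum: "(\<Sum>m<3. P m (t, 0) / fact m * u ^ m) = P 0 (t, 0) + P 1 (t, 0) * u + P 2 (t, 0) / 2 * u\<^sup>2"
      by (simp add: eval_nat_numeral)
    have "P 0 (t, 0) = 0" using P(1)[of "(t, 0)"] f0(1)[OF tu(1)] tu f(2) by simp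
    then have "f (t, u) - P 2 (t, 0) / 2 * u\<^sup>2 = P 3 (t, z) / fact 3 * u ^ 3"
      using z(2) P1[OF tu(1)] P(1)[of "(t, u)"] tu sum by simp
    moreover have "(t, z) \<in> ?A" using z(1) tu by auto
    then have "\<bar>P 3 (t, z) / fact 3 * u ^ 3\<bar> \<le> M / 6 * \<bar>u\<bar>^3"
      using mult_right_mono[OF M, of "(t, z)" "\<bar>u\<bar>^3"] by (simp add: fact_numeral abs_mult power_abs)
    ultimately show ?thesis by simp
  qed
  have k_cont: "continuous_on {a..b} (\<lambda>t. P 2 (t, 0))"
    by (rule continuous_on_compose2[OF cont]) (use f(2) in \<open>auto intro!: continuous_intros\<close>)
  have f_cont: "continuous_on ?A f"
    by (rule continuous_on_eq[OF cont P(1)])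
  show thesis
    by (rule that[of ft "\<lambda>t u. P 1 (t, u)", OF f_t f_u P1 f_cont k_cont est])
qed

text \<open>Serves both the cross product, for the conormal h, and the inner product, for \<kappa>
  and \<tau>.\<close>

lemma C1_differentiable_on_bilinear:
  assumes "bounded_bilinear p" "f C1_differentiable_on S" "g C1_differentiable_on S"
  shows "(\<lambda>t. p (f t) (g t)) C1_differentiable_on S"
proof -
  obtain f' g' where
    f: "\<And>t. t \<in> S \<Longrightarrow> (f has_vector_derivative f' t) (at t)" "continuous_on S f'" and
    g: "\<And>t. t \<in> S \<Longrightarrow> (g has_vector_derivative g' t) (at t)" "continuous_on S g'"
    using assms(2,3) unfolding C1_differentiable_on_def by metis
  have "continuous_on S f" "continuous_on S g"
    using assms(2,3) C1_differentiable_imp_continuous_on by auto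
  then show ?thesis
    unfolding C1_differentiable_on_def
    by (intro exI[of _ "\<lambda>t. p (f t) (g' t) + p (f' t) (g t)"] conjI ballI
        bounded_bilinear.has_vector_derivative[OF assms(1) f(1) g(1)] continuous_on_add
        bounded_bilinear.continuous_on[OF assms(1)] f(2) g(2))
qed

lemma C1_differentiable_on_inverse_sqrt:
  fixes f :: "real \<Rightarrow> real"
  assumes "f C1_differentiable_on S" "\<And>t. t \<in> S \<Longrightarrow> 0 < f t"
  shows "(\<lambda>t. inverse (sqrt (f t))) C1_differentiable_on S"
proof -
  obtain f' where f: "\<And>t. t \<in> S \<Longrightarrow> (f has_real_derivative f' t) (at t)" "continuous_on S f'"
    using assms(1) unfolding C1_differentiable_on_def has_real_derivative_iff_has_vector_derivative by metis
  have "continuous_on S f" using assms(1) C1_differentiable_imp_continuous_on by auto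
  then have cont: "continuous_on S (\<lambda>t. - (inverse (sqrt (f t)) / 2 * f' t * inverse (sqrt (f t) ^ Suc (Suc 0))))"
    using assms(2) by (intro continuous_intros f(2)) (auto simp: less_imp_neq[symmetric])
  have deriv: "((\<lambda>t. inverse (sqrt (f t))) has_real_derivative
      - (inverse (sqrt (f t)) / 2 * f' t * inverse (sqrt (f t) ^ Suc (Suc 0)))) (at t)" if "t \<in> S" for t
    using assms(2)[OF that]
    by (intro DERIV_inverse_fun DERIV_chain2[OF DERIV_real_sqrt f(1)[OF that]]) auto
  show ?thesis
    unfolding C1_differentiable_on_def has_real_derivative_iff_has_vector_derivative[symmetric]
    using deriv cont by (intro exI conjI ballI)
qed

lemma bounded_bilinear_cross3: "bounded_bilinear cross3"
  using bilinear_cross bilinear_conv_bounded_bilinear by blast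

text \<open>This removes the derivatives of the height function from the Jacobian, since they occur
  only as coefficients of N.\<close>

lemma triple_product_shear: "cross3 (v + c *\<^sub>R n) (w + d *\<^sub>R n) \<bullet> n = cross3 v w \<bullet> n"
  by (simp add: cross_add_left cross_add_right cross_mult_left cross_mult_right inner_add_left dot_cross_self)

text \<open>The hypothesis \<open>graph\<close> ties f to S. One f is given on a rectangle of
  half-width \<epsilon>0, and its restrictions to smaller \<epsilon> enter the expansion. The first
  conjunct follows from the second, as \<open>\<bar>\<tau>g t\<bar> = \<tau>g t\<close> under its
  premise.\<close>

theorem theorem3p9:
  fixes S :: "(real^3) set"
    and \<alpha> \<epsilon>0 :: real
    and \<gamma> N \<beta> :: "real \<Rightarrow> real^3"
    and \<kappa>g \<kappa>n \<tau>g wm wp H K :: "real \<Rightarrow> real"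
    and f :: "real \<times> real \<Rightarrow> real"
  defines "\<beta> \<equiv> ruling {0..\<alpha>} \<gamma> N \<kappa>n \<tau>g"
    and "H \<equiv> \<lambda>t. mean_curvature S (\<gamma> t) (N t)"
    and "K \<equiv> \<lambda>t. gauss_curvature S (\<gamma> t) (N t)"
  assumes surface: "regular_surface S"
    and "0 < \<alpha>"
    and curve: "smooth_on {0..\<alpha>} \<gamma>" "\<gamma> ` {0..\<alpha>} \<subseteq> S"
    and unit_speed: "\<And>t. t \<in> {0..\<alpha>} \<Longrightarrow> norm (vector_derivative \<gamma> (at t within {0..\<alpha>})) = 1"
    and normal: "smooth_on {0..\<alpha>} N" "\<And>t. t \<in> {0..\<alpha>} \<Longrightarrow> unit_normal S (\<gamma> t) (N t)"
    and darboux: "darboux_equations {0..\<alpha>} \<gamma> N \<kappa>g \<kappa>n \<tau>g"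
    and \<kappa>n_nonzero: "\<And>t. t \<in> {0..\<alpha>} \<Longrightarrow> \<kappa>n t \<noteq> 0"
    and widths: "\<And>t. t \<in> {0..\<alpha>} \<Longrightarrow> 0 < wm t \<and> 0 < wp t"
    and ribbon_regular: "regular_ribbon {0..\<alpha>} \<gamma> \<beta> wm wp"
    and \<epsilon>0: "0 < \<epsilon>0" "\<And>t. t \<in> {0..\<alpha>} \<Longrightarrow> \<epsilon>0 < wm t \<and> \<epsilon>0 < wp t"
    and height_smooth: "smooth_on ({0..\<alpha>} \<times> {-\<epsilon>0..\<epsilon>0}) f"
    and height_zero: "\<And>t. t \<in> {0..\<alpha>} \<Longrightarrow> f (t, 0) = 0"
      "\<And>t. t \<in> {0..\<alpha>} \<Longrightarrow> vector_derivative (\<lambda>u. f (t, u)) (at 0 within {-\<epsilon>0..\<epsilon>0}) = 0"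
    and graph: "\<And>t u. t \<in> {0..\<alpha>} \<Longrightarrow> u \<in> {-\<epsilon>0..\<epsilon>0} \<Longrightarrow> graph_over_ribbon \<gamma> \<beta> N f t u \<in> S"
  shows "((\<forall>t\<in>{0..\<alpha>}. 0 \<le> \<tau>g t) \<longrightarrow>
           (\<lambda>\<epsilon>. goodness \<alpha> \<gamma> \<beta> N f \<epsilon> -
              1/3 * \<epsilon>^3 * integral {0..\<alpha>} (\<lambda>t. goodness_density (H t) (K t) (\<kappa>n t) (\<tau>g t)))
           \<in> O[at_right 0](\<lambda>\<epsilon>. \<epsilon>^4)) \<and>
         (\<lambda>\<epsilon>. goodness \<alpha> \<gamma> \<beta> N f \<epsilon> -
              1/3 * \<epsilon>^3 * integral {0..\<alpha>} (\<lambda>t. goodness_density (H t) (K t) (\<kappa>n t) \<bar>\<tau>g t\<bar>))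
           \<in> O[at_right 0](\<lambda>\<epsilon>. \<epsilon>^4)"
proof -
  let ?J = "{0..\<alpha>}"
  have not_isolated: "at t within {a..b} \<noteq> bot" if "a < b" "t \<in> {a..b}" for a b t :: real
    using that islimpt_Icc by (simp add: trivial_limit_within)

  \<comment> \<open>The Darboux frame and the ruling as continuously differentiable
    functions\<close>
  obtain G where G0: "\<And>t. t \<in> ?J \<Longrightarrow> G 0 t = \<gamma> t"
    and G: "\<And>n t. t \<in> ?J \<Longrightarrow> (G n has_vector_derivative G (Suc n) t) (at t)"
    using smooth_curve_iterated_derivative[OF curve(1)] by metis
  obtain M where M0: "\<And>t. t \<in> ?J \<Longrightarrow> M 0 t = N t"
    and M: "\<And>n t. t \<in> ?J \<Longrightarrow> (M n has_vector_derivative M (Suc n) t) (at t)"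
    using smooth_curve_iterated_derivative[OF normal(1)] by metis
  have G_cont: "continuous_on ?J (G n)" and M_cont: "continuous_on ?J (M n)" for n
    using G M has_vector_derivative_continuous continuous_at_imp_continuous_on by metis+
  have G_C1: "G n C1_differentiable_on ?J" and M_C1: "M n C1_differentiable_on ?J" for n
    unfolding C1_differentiable_on_def using G M G_cont M_cont by blast+
  define e where "e = G 1"
  define h where "h t = cross3 (M 0 t) (e t)" for t

  have \<gamma>_deriv: "(\<gamma> has_vector_derivative e t) (at t within ?J)" if "t \<in> ?J" for t
    by (rule has_vector_derivative_transform[OF that, of \<gamma> "G 0"])
      (use G0 G[OF that, of 0] that in \<open>auto simp: e_def intro: has_vector_derivative_at_within\<close>)
  have N_deriv: "(N has_vector_derivative M 1 t) (at t within ?J)" if "t \<in> ?J" for t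
    by (rule has_vector_derivative_transform[OF that, of N "M 0"])
      (use M0 M[OF that, of 0] that in \<open>auto intro: has_vector_derivative_at_within\<close>)
  have velocity: "vector_derivative \<gamma> (at t within ?J) = e t" if "t \<in> ?J" for t
    by (rule vector_derivative_within_closed_interval[OF \<open>0 < \<alpha>\<close> that \<gamma>_deriv[OF that]])
  have norm_e: "norm (e t) = 1" if "t \<in> ?J" for t
    using unit_speed[OF that] velocity[OF that] by simp
  have tangent: "unit_tangent ?J \<gamma> t = e t" if "t \<in> ?J" for t
    unfolding unit_tangent_def velocity[OF that] norm_e[OF that] by simp
  have conormal: "conormal ?J \<gamma> N t = h t" if "t \<in> ?J" for t
    unfolding conormal_def tangent[OF that] h_def M0[OF that] ..
  have NN: "N t \<bullet> N t = 1" and ee: "e t \<bullet> e t = 1" if "t \<in> ?J" for t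
    using normal(2)[OF that] norm_e[OF that] by (simp_all add: unit_normal_def dot_square_norm)
  have Ne: "N t \<bullet> e t = 0" if "t \<in> ?J" for t
    by (rule normal_orthogonal_velocity[OF surface that not_isolated[OF \<open>0 < \<alpha>\<close> that] curve(2)
          \<gamma>_deriv[OF that] normal(2)[OF that]])
  have h: "h t \<bullet> N t = 0" "h t \<bullet> e t = 0" "h t \<bullet> h t = 1" "e t \<bullet> h t = 0" "N t \<bullet> h t = 0" if "t \<in> ?J" for t
    using NN[OF that] ee[OF that] Ne[OF that]
    by (simp_all add: h_def M0[OF that] dot_cross_self dot_cross)
  \<comment> \<open>The extensions and the frame equations both provide a derivative within J, and
    these agree because no point of J is isolated.\<close>
  have e_eq: "G 2 t = \<kappa>g t *\<^sub>R h t + \<kappa>n t *\<^sub>R N t" and N_eq: "M 1 t = - \<kappa>n t *\<^sub>R e t - \<tau>g t *\<^sub>R h t"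
    if "t \<in> ?J" for t
  proof -
    have *: "(unit_tangent ?J \<gamma> has_vector_derivative \<kappa>g t *\<^sub>R h t + \<kappa>n t *\<^sub>R N t) (at t within ?J)"
      "(N has_vector_derivative - \<kappa>n t *\<^sub>R e t - \<tau>g t *\<^sub>R h t) (at t within ?J)"
      using bspec[OF darboux[unfolded darboux_equations_def Let_def] that]
      by (simp_all add: tangent[OF that] conormal[OF that] velocity[OF that] norm_e[OF that])
    have "(unit_tangent ?J \<gamma> has_vector_derivative G 2 t) (at t within ?J)"
      by (rule has_vector_derivative_transform[OF that tangent])
        (use G[OF that, of 1] in \<open>auto simp: e_def numeral_2_eq_2 intro: has_vector_derivative_at_within\<close>)
    then show "G 2 t = \<kappa>g t *\<^sub>R h t + \<kappa>n t *\<^sub>R N t"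
      using vector_derivative_unique_within[OF not_isolated[OF \<open>0 < \<alpha>\<close> that] _ *(1)] by blast
    show "M 1 t = - \<kappa>n t *\<^sub>R e t - \<tau>g t *\<^sub>R h t"
      using vector_derivative_unique_within[OF not_isolated[OF \<open>0 < \<alpha>\<close> that] N_deriv[OF that] *(2)] .
  qed

  \<comment> \<open>No regularity of \<kappa>n and \<tau>g is assumed. These functions agree with
    them on J and are built from G and M, hence continuously differentiable there with two-sided
    derivatives at the end points.\<close>
  define \<kappa> where "\<kappa> t = G 2 t \<bullet> M 0 t" for t
  define \<tau> where "\<tau> t = - (M 1 t \<bullet> h t)" for t
  have \<kappa>: "\<kappa> t = \<kappa>n t" and \<tau>: "\<tau> t = \<tau>g t" if "t \<in> ?J" for t
    unfolding \<kappa>_def \<tau>_def e_eq[OF that] N_eq[OF that] M0[OF that]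
    using h[OF that] NN[OF that] by (simp_all add: inner_add_left inner_diff_left)
  define \<rho> where "\<rho> t = sqrt ((\<kappa> t)\<^sup>2 + (\<tau> t)\<^sup>2)" for t
  define \<beta>' where "\<beta>' t = inverse (\<rho> t) *\<^sub>R (\<kappa> t *\<^sub>R h t - \<tau> t *\<^sub>R e t)" for t
  have \<beta>: "\<beta> t = \<beta>' t" if "t \<in> ?J" for t
    unfolding \<beta>_def ruling_def \<beta>'_def \<rho>_def \<kappa>[OF that] \<tau>[OF that] tangent[OF that] conormal[OF that] ..
  have "\<beta>' C1_differentiable_on ?J"
  proof -
    have h_C1: "h C1_differentiable_on ?J"
      unfolding h_def[abs_def] e_def by (rule C1_differentiable_on_bilinear[OF bounded_bilinear_cross3 M_C1 G_C1])
    have \<kappa>_C1: "\<kappa> C1_differentiable_on ?J"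
      unfolding \<kappa>_def[abs_def] by (rule C1_differentiable_on_bilinear[OF bounded_bilinear_inner G_C1 M_C1])
    have \<tau>_C1: "\<tau> C1_differentiable_on ?J"
      unfolding \<tau>_def[abs_def]
      by (rule C1_differentiable_on_minus[OF C1_differentiable_on_bilinear[OF bounded_bilinear_inner M_C1 h_C1]])
    show ?thesis
      unfolding \<beta>'_def[abs_def] \<rho>_def
    proof (intro C1_differentiable_on_scaleR C1_differentiable_on_inverse_sqrt C1_differentiable_on_diff
        \<kappa>_C1 \<tau>_C1 h_C1)
      show "e C1_differentiable_on ?J" unfolding e_def by (rule G_C1)
      show "(\<lambda>t. (\<kappa> t)\<^sup>2 + (\<tau> t)\<^sup>2) C1_differentiable_on ?J"
        unfolding power2_eq_square by (intro C1_differentiable_on_add C1_differentiable_on_mult \<kappa>_C1 \<tau>_C1)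
      show "0 < (\<kappa> t)\<^sup>2 + (\<tau> t)\<^sup>2" if "t \<in> ?J" for t
        using \<kappa>n_nonzero[OF that] \<kappa>[OF that] by (simp add: add_pos_nonneg)
    qed
  qed
  then obtain b where b: "\<And>t. t \<in> ?J \<Longrightarrow> (\<beta>' has_vector_derivative b t) (at t)" "continuous_on ?J b"
    and \<beta>'_cont: "continuous_on ?J \<beta>'"
    using C1_differentiable_imp_continuous_on unfolding C1_differentiable_on_def by metis
  have \<beta>_deriv: "(\<beta> has_vector_derivative b t) (at t within ?J)" if "t \<in> ?J" for t
    by (rule has_vector_derivative_transform[OF that \<beta>])
      (use b(1)[OF that] in \<open>auto intro: has_vector_derivative_at_within\<close>)

  \<comment> \<open>The height function and the density at each point of the curve\<close>
  obtain ft fu k C where f: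
    "\<And>t u. t \<in> ?J \<Longrightarrow> u \<in> {-\<epsilon>0..\<epsilon>0} \<Longrightarrow> ((\<lambda>s. f (s, u)) has_vector_derivative ft t u) (at t within ?J)"
    "\<And>t u. t \<in> ?J \<Longrightarrow> u \<in> {-\<epsilon>0..\<epsilon>0} \<Longrightarrow>
      ((\<lambda>v. f (t, v)) has_vector_derivative fu t u) (at u within {-\<epsilon>0..\<epsilon>0})"
    "\<And>t. t \<in> ?J \<Longrightarrow> fu t 0 = 0"
    "continuous_on (?J \<times> {-\<epsilon>0..\<epsilon>0}) f" "continuous_on ?J k"
    "\<And>t u. t \<in> ?J \<Longrightarrow> u \<in> {-\<epsilon>0..\<epsilon>0} \<Longrightarrow> \<bar>f (t, u) - k t / 2 * u\<^sup>2\<bar> \<le> C * \<bar>u\<bar>^3"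
    by (rule height_expansion[OF height_smooth \<epsilon>0(1) height_zero]) blast+

  have density: "goodness_density (H t) (K t) (\<kappa>n t) \<bar>\<tau>g t\<bar> = \<bar>k t * (\<kappa>n t / \<rho> t)\<bar>" if t: "t \<in> ?J" for t
  proof -
    have "((\<lambda>u. f (t, u) / u\<^sup>2) \<longlongrightarrow> k t / 2) (at 0 within {-\<epsilon>0..\<epsilon>0})"
    proof (rule LIM_zero_cancel, rule Lim_null_comparison)
      have "\<bar>f (t, u) / u\<^sup>2 - k t / 2\<bar> \<le> C * \<bar>u\<bar>" if "u \<in> {-\<epsilon>0..\<epsilon>0}" "u \<noteq> 0" for u
      proof -
        have "f (t, u) / u\<^sup>2 - k t / 2 = (f (t, u) - k t / 2 * u\<^sup>2) / u\<^sup>2"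
          using that(2) by (simp add: field_simps)
        then have "\<bar>f (t, u) / u\<^sup>2 - k t / 2\<bar> = \<bar>f (t, u) - k t / 2 * u\<^sup>2\<bar> / \<bar>u\<bar>\<^sup>2" by simp
        also have "\<dots> \<le> C * \<bar>u\<bar>^3 / \<bar>u\<bar>\<^sup>2"
          by (rule divide_right_mono[OF f(6)[OF t that(1)]]) simp
        also have "\<dots> = C * \<bar>u\<bar>"
          using that(2) by (simp add: power3_eq_cube power2_eq_square)
        finally show ?thesis .
      qed
      then show "\<forall>\<^sub>F u in at 0 within {-\<epsilon>0..\<epsilon>0}. norm (f (t, u) / u\<^sup>2 - k t / 2) \<le> C * \<bar>u\<bar>"
        unfolding eventually_at_filter by (intro always_eventually) simp
      show "((\<lambda>u. C * \<bar>u\<bar>) \<longlongrightarrow> 0) (at 0 within {-\<epsilon>0..\<epsilon>0})"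
        by (rule tendsto_eq_intros refl | simp)+
    qed
    moreover have "\<gamma> t + u *\<^sub>R \<beta> t + f (t, u) *\<^sub>R N t \<in> S" if "u \<in> {-\<epsilon>0..\<epsilon>0}" for u
      using graph[OF t that] unfolding graph_over_ribbon_def .
    moreover have "((\<lambda>u. f (t, u)) has_vector_derivative 0) (at 0 within {-\<epsilon>0..\<epsilon>0})"
      using f(2)[OF t, of 0] f(3)[OF t] \<epsilon>0(1) by simp
    moreover have "\<beta> t = (\<kappa>n t *\<^sub>R cross3 (N t) (e t) - \<tau>g t *\<^sub>R e t) /\<^sub>R sqrt ((\<kappa>n t)\<^sup>2 + (\<tau>g t)\<^sup>2)"
      unfolding \<beta>_def ruling_def tangent[OF t] conormal[OF t] h_def M0[OF t] ..
    moreover have "(N has_vector_derivative - \<kappa>n t *\<^sub>R e t - \<tau>g t *\<^sub>R cross3 (N t) (e t)) (at t within ?J)"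
      using N_deriv[OF t] unfolding N_eq[OF t] h_def M0[OF t] .
    moreover have "0 \<in> {-\<epsilon>0..\<epsilon>0}" "at 0 within {-\<epsilon>0..\<epsilon>0} \<noteq> bot"
      using \<epsilon>0(1) not_isolated[of "-\<epsilon>0" \<epsilon>0 0] by auto
    ultimately show ?thesis
      unfolding H_def K_def \<rho>_def \<kappa>[OF t] \<tau>[OF t]
      by (intro density_at_point[OF surface t not_isolated[OF \<open>0 < \<alpha>\<close> t] curve(2) \<gamma>_deriv[OF t] norm_e[OF t]
            normal(2) _ \<kappa>n_nonzero[OF t], where V = "{-\<epsilon>0..\<epsilon>0}" and g = "\<lambda>u. f (t, u)"] height_zero(1)[OF t])
  qed

  \<comment> \<open>The Jacobian of the domain\<close>
  define a where "a t = cross3 (e t) (\<beta>' t) \<bullet> M 0 t" for t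
  define p where "p t = cross3 (b t) (\<beta>' t) \<bullet> M 0 t" for t
  define r where "r t = cross3 (M 1 t) (\<beta>' t) \<bullet> M 0 t" for t
  have a: "a t = \<kappa>n t / \<rho> t" if t: "t \<in> ?J" for t
  proof -
    have "cross3 (e t) (h t) = N t"
      unfolding h_def M0[OF t] Lagrange using ee[OF t] Ne[OF t] by (simp add: inner_commute)
    then show ?thesis
      unfolding a_def \<beta>'_def M0[OF t] using NN[OF t] \<kappa>[OF t]
      by (simp add: cross_mult_right Cross3.right_diff_distrib divide_inverse)
  qed
  have cross_cont: "continuous_on ?J (\<lambda>t. cross3 (v t) (\<beta>' t) \<bullet> M 0 t)" if "continuous_on ?J v" for v
    by (intro continuous_on_inner continuous_on_cross that \<beta>'_cont M_cont)

  have integrand: "\<bar>cross3 (vector_derivative (\<lambda>s. domain_between \<gamma> \<beta> N f s u w) (at t within ?J))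
        (vector_derivative (\<lambda>v. domain_between \<gamma> \<beta> N f t v w) (at u within {-\<epsilon>..\<epsilon>}))
        \<bullet> vector_derivative (\<lambda>z. domain_between \<gamma> \<beta> N f t u z) (at w within {0..1})\<bar>
      = \<bar>f (t, u) * (a t + u * p t + w * f (t, u) * r t)\<bar>"
    if t: "t \<in> ?J" and u: "u \<in> {-\<epsilon>..\<epsilon>}" and w: "w \<in> {0..1}" and \<epsilon>: "0 < \<epsilon>" "\<epsilon> \<le> \<epsilon>0" for t u w \<epsilon>
  proof -
    have u': "u \<in> {-\<epsilon>0..\<epsilon>0}" using u \<epsilon> by auto
    let ?X = "e t + u *\<^sub>R b t + (w * f (t, u)) *\<^sub>R M 1 t"
    have "((\<lambda>s. domain_between \<gamma> \<beta> N f s u w) has_vector_derivative ?X + (w * ft t u) *\<^sub>R N t) (at t within ?J)"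
      unfolding domain_between_def
      using \<gamma>_deriv[OF t] \<beta>_deriv[OF t] N_deriv[OF t] f(1)[OF t u']
      by (auto intro!: derivative_eq_intros simp: has_real_derivative_iff_has_vector_derivative)
    then have t_deriv: "vector_derivative (\<lambda>s. domain_between \<gamma> \<beta> N f s u w) (at t within ?J) = ?X + (w * ft t u) *\<^sub>R N t"
      by (rule vector_derivative_within_closed_interval[OF \<open>0 < \<alpha>\<close> t])
    \<comment> \<open>\<open>goodness\<close> takes the derivative within the smaller interval;
      restriction keeps its value, and 0 < \<epsilon> keeps it unique.\<close>
    have "((\<lambda>v. f (t, v)) has_vector_derivative fu t u) (at u within {-\<epsilon>..\<epsilon>})"
      by (rule has_vector_derivative_within_subset[OF f(2)[OF t u']]) (use \<epsilon> in auto)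
    then have "((\<lambda>v. domain_between \<gamma> \<beta> N f t v w) has_vector_derivative \<beta> t + (w * fu t u) *\<^sub>R N t) (at u within {-\<epsilon>..\<epsilon>})"
      unfolding domain_between_def
      by (auto intro!: derivative_eq_intros simp: has_real_derivative_iff_has_vector_derivative)
    then have u_deriv: "vector_derivative (\<lambda>v. domain_between \<gamma> \<beta> N f t v w) (at u within {-\<epsilon>..\<epsilon>}) = \<beta> t + (w * fu t u) *\<^sub>R N t"
      using vector_derivative_within_closed_interval[OF _ u] \<epsilon>(1) by simp
    have "((\<lambda>z. domain_between \<gamma> \<beta> N f t u z) has_vector_derivative f (t, u) *\<^sub>R N t) (at w within {0..1})"
      unfolding domain_between_def
      by (auto intro!: derivative_eq_intros simp: has_real_derivative_iff_has_vector_derivative)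
    then have w_deriv: "vector_derivative (\<lambda>z. domain_between \<gamma> \<beta> N f t u z) (at w within {0..1}) = f (t, u) *\<^sub>R N t"
      by (rule vector_derivative_within_closed_interval[OF zero_less_one w])
    \<comment> \<open>Linearity splits the triple product along the three summands of ?X, which
      yield a, p and r in turn.\<close>
    have "cross3 ?X (\<beta> t) \<bullet> N t = a t + u * p t + w * f (t, u) * r t"
      unfolding a_def p_def r_def \<beta>[OF t] M0[OF t]
      by (simp add: cross_add_left cross_mult_left inner_add_left)
    then show ?thesis
      unfolding t_deriv u_deriv w_deriv inner_scaleR_right triple_product_shear by simp
  qed

  \<comment> \<open>The expansion of the goodness\<close>
  obtain D where D: "\<And>\<epsilon>. 0 < \<epsilon> \<Longrightarrow> \<epsilon> \<le> \<epsilon>0 \<Longrightarrow>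
    \<bar>integral ?J (\<lambda>t. integral {-\<epsilon>..\<epsilon>} (\<lambda>u. integral {0..1} (\<lambda>w.
        \<bar>f (t, u) * (a t + u * p t + w * f (t, u) * r t)\<bar>)))
      - 1/3 * \<epsilon>^3 * integral ?J (\<lambda>t. \<bar>k t * a t\<bar>)\<bar> \<le> D * \<epsilon>^4"
  proof (rule thin_domain_volume[OF less_imp_le[OF \<open>0 < \<alpha>\<close>] \<epsilon>0(1) f(4) _ _ _ f(5,6)])
    show "continuous_on ?J a" "continuous_on ?J p" "continuous_on ?J r"
      unfolding a_def[abs_def] p_def[abs_def] r_def[abs_def] e_def
      by (intro cross_cont G_cont M_cont b(2))+
  qed blast+
  have goodness_eq: "goodness \<alpha> \<gamma> \<beta> N f \<epsilon> = integral ?J (\<lambda>t. integral {-\<epsilon>..\<epsilon>} (\<lambda>u. integral {0..1} (\<lambda>w.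
        \<bar>f (t, u) * (a t + u * p t + w * f (t, u) * r t)\<bar>)))" if "0 < \<epsilon>" "\<epsilon> \<le> \<epsilon>0" for \<epsilon>
    unfolding goodness_def Let_def by (intro integral_cong integrand that)
  have density_eq: "integral ?J (\<lambda>t. goodness_density (H t) (K t) (\<kappa>n t) \<bar>\<tau>g t\<bar>) = integral ?J (\<lambda>t. \<bar>k t * a t\<bar>)"
    by (rule integral_cong) (simp add: density a)
  have "\<forall>\<^sub>F \<epsilon> in at_right 0. norm (goodness \<alpha> \<gamma> \<beta> N f \<epsilon> -
      1/3 * \<epsilon>^3 * integral ?J (\<lambda>t. goodness_density (H t) (K t) (\<kappa>n t) \<bar>\<tau>g t\<bar>)) \<le> D * norm (\<epsilon>^4)"
    using eventually_at_right_less[of 0] eventually_at_right_real[OF \<epsilon>0(1)]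
  proof eventually_elim
    case (elim \<epsilon>)
    then show ?case using D[of \<epsilon>] by (simp add: goodness_eq density_eq)
  qed
  then have main: "(\<lambda>\<epsilon>. goodness \<alpha> \<gamma> \<beta> N f \<epsilon> -
      1/3 * \<epsilon>^3 * integral ?J (\<lambda>t. goodness_density (H t) (K t) (\<kappa>n t) \<bar>\<tau>g t\<bar>)) \<in> O[at_right 0](\<lambda>\<epsilon>. \<epsilon>^4)"
    by (rule bigoI)
  show ?thesis
  proof (intro conjI impI main)
    assume "\<forall>t\<in>?J. 0 \<le> \<tau>g t"
    then have "integral ?J (\<lambda>t. goodness_density (H t) (K t) (\<kappa>n t) \<bar>\<tau>g t\<bar>)
        = integral ?J (\<lambda>t. goodness_density (H t) (K t) (\<kappa>n t) (\<tau>g t))"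
      by (intro integral_cong) simp
    from main[unfolded this]
    show "(\<lambda>\<epsilon>. goodness \<alpha> \<gamma> \<beta> N f \<epsilon> -
        1/3 * \<epsilon>^3 * integral ?J (\<lambda>t. goodness_density (H t) (K t) (\<kappa>n t) (\<tau>g t))) \<in> O[at_right 0](\<lambda>\<epsilon>. \<epsilon>^4)" .
  qed
qed

end
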